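(* The bracket defined for functions $f,g\in C^\infty(\mathbb{R}^3\times\mathbb{R}^3)$ of $(\gamma,K)\in\mathbb{R}^3\times\mathbb{R}^3$ by $$\{f,g\}_{\mathrm{Rank}1}=-\bigl(K+mr^2(\Omega\cdot\gamma)\gamma\bigr)\cdot\left(\frac{\partial f}{\partial K}\times\frac{\partial g}{\partial K}\right)-\gamma\cdot\left(\frac{\partial f}{\partial K}\times\frac{\partial g}{\partial\gamma}-\frac{\partial g}{\partial K}\times\frac{\partial f}{\partial\gamma}\right)$$ is conformally Poisson with conformal factor $$\varphi(\gamma)=\sqrt{\|\gamma\|^2+mr^2\,(\gamma\cdot\mathbb{I}^{-1}\gamma)}.$$
   Context: Here $m$ is the mass of a rigid body, $\mathbb{I}=\mathrm{diag}(I_1,I_2,I_3)$ its inertia tensor, with positive entries, and $r$ a constant with dimensions of length. The body, with attitude $g\in SO(3)$, center of mass $\mathbf{x}$, space angular velocity $\omega$ and body angular velocity $\Omega=g^{-1}\omega$, is subject to the constraint $\dot{\mathbf x}=rA\omega$ with $A=e_3e_3^T$ (rank 1), $\gamma=g^{-1}e_3$, and its kinetic momentum is $K=\mathbb{I}\Omega+mr^2(\Omega\cdot\gamma)\gamma$. In the bracket, $\Omega$ is regarded as the function of $(\gamma,K)$ given by the expression $$\Omega=\mathbb{I}^{-1}K-mr^2\left(\frac{K\cdot\mathbb{I}^{-1}\gamma}{\|\gamma\|^2+mr^2(\gamma\cdot\mathbb{I}^{-1}\gamma)}\right)\mathbb{I}^{-1}\gamma.$$ An almost Poisson bracket (bilinear,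 skew-symmetric, satisfying the Leibniz rule, but not necessarily the Jacobi identity) $\{\cdot,\cdot\}$ is called conformally Poisson if there exists a strictly positive smooth function $\varphi$, the conformal factor, such that the bracket $\varphi\{\cdot,\cdot\}$ satisfies the Jacobi identity.
   Formalization: As stated, the Jacobi identity fails off ‖γ‖=1, and at γ=0 Ω is undefined and φ=0. Proved instead: the Jacobi identity for φ times the given bracket on ‖γ‖=1, and the claim for all γ≠0 with (Ω·γ)γ replaced by (Ω·γ)γ/‖γ‖². *)

theory Defs
  imports "HOL-Analysis.Analysis"
begin

text \<open>For open \<open>U\<close> in a finite-dimensional space, \<open>k\<close>-fold continuous differentiability
  through iterated directional derivatives. Values off \<open>U\<close> are irrelevant, so a total function with
  \<open>smooth_on U f\<close> represents an element of \<open>C\<^sup>\<infinity>(U)\<close>.\<close>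

primrec Ck_on :: "nat \<Rightarrow> 'a set \<Rightarrow> ('a::real_normed_vector \<Rightarrow> real) \<Rightarrow> bool" where
  "Ck_on 0 U f \<longleftrightarrow> continuous_on U f"
| "Ck_on (Suc k) U f \<longleftrightarrow> (\<forall>x\<in>U. f differentiable (at x)) \<and>
     (\<forall>v. Ck_on k U (\<lambda>x. frechet_derivative f (at x) v))"

definition smooth_on :: "'a set \<Rightarrow> ('a::real_normed_vector \<Rightarrow> real) \<Rightarrow> bool" where
  "smooth_on U f \<longleftrightarrow> (\<forall>k. Ck_on k U f)"

type_synonym 'a bracket = "('a \<Rightarrow> real) \<Rightarrow> ('a \<Rightarrow> real) \<Rightarrow> 'a \<Rightarrow> real"

text \<open>Brackets on a submanifold \<open>M\<close> that is closed in the open set \<open>U\<close>; there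
  \<open>C\<^sup>\<infinity>(M)\<close> consists of the restrictions to \<open>M\<close> of the elements of \<open>C\<^sup>\<infinity>(U)\<close>. A bracket
  on \<open>C\<^sup>\<infinity>(U)\<close> induces one on \<open>C\<^sup>\<infinity>(M)\<close> exactly if \<open>{f,g}\<close> vanishes on \<open>M\<close> as soon as
  \<open>f\<close> does. Taking \<open>M = U\<close> gives the notions on the open set \<open>U\<close> itself; the condition
  then only says that the bracket does not depend on values off \<open>U\<close>.\<close>

definition restricts_to :: "'a set \<Rightarrow> 'a set \<Rightarrow> 'a::real_normed_vector bracket \<Rightarrow> bool" where
  "restricts_to U M B \<longleftrightarrow> (\<forall>f g. smooth_on U f \<and> smooth_on U g \<and> (\<forall>x\<in>M. f x = 0)
     \<longrightarrow> (\<forall>x\<in>M. B f g x = 0))"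

definition almost_poisson_bracket ::
  "'a set \<Rightarrow> 'a set \<Rightarrow> 'a::real_normed_vector bracket \<Rightarrow> bool" where
  "almost_poisson_bracket U M B \<longleftrightarrow>
     (\<forall>f g. smooth_on U f \<and> smooth_on U g \<longrightarrow> smooth_on U (B f g)) \<and>
     (\<forall>f g h a b. smooth_on U f \<and> smooth_on U g \<and> smooth_on U h \<longrightarrow> (\<forall>x\<in>U.
        B (\<lambda>y. a * f y + b * g y) h x = a * B f h x + b * B g h x \<and>
        B h (\<lambda>y. a * f y + b * g y) x = a * B h f x + b * B h g x)) \<and>
     (\<forall>f g. smooth_on U f \<and> smooth_on U g \<longrightarrow> (\<forall>x\<in>U. B f g x = - B g f x)) \<and>
     (\<forall>f g h. smooth_on U f \<and> smooth_on U g \<and> smooth_on U h \<longrightarrow> (\<forall>x\<in>U.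
        B (\<lambda>y. f y * g y) h x = f x * B g h x + g x * B f h x)) \<and>
     restricts_to U M B"

definition jacobi_identity :: "'a set \<Rightarrow> 'a set \<Rightarrow> 'a::real_normed_vector bracket \<Rightarrow> bool" where
  "jacobi_identity U M B \<longleftrightarrow>
     (\<forall>f g h. smooth_on U f \<and> smooth_on U g \<and> smooth_on U h \<longrightarrow> (\<forall>x\<in>M.
        B (B f g) h x + B (B g h) f x + B (B h f) g x = 0))"

definition conformal_factor ::
  "'a set \<Rightarrow> 'a set \<Rightarrow> ('a \<Rightarrow> real) \<Rightarrow> 'a::real_normed_vector bracket \<Rightarrow> bool" where
  "conformal_factor U M \<phi> B \<longleftrightarrow> smooth_on U \<phi> \<and> (\<forall>x\<in>U. 0 < \<phi> x) \<and>
     jacobi_identity U M (\<lambda>f g x. \<phi> x * B f g x)"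

definition conformally_poisson ::
  "'a set \<Rightarrow> 'a set \<Rightarrow> 'a::real_normed_vector bracket \<Rightarrow> bool" where
  "conformally_poisson U M B \<longleftrightarrow>
     almost_poisson_bracket U M B \<and> (\<exists>\<phi>. conformal_factor U M \<phi> B)"

definition inertia_tensor :: "real \<Rightarrow> real \<Rightarrow> real \<Rightarrow> real^3^3" where
  "inertia_tensor I\<^sub>1 I\<^sub>2 I\<^sub>3 =
     vector [vector [I\<^sub>1, 0, 0], vector [0, I\<^sub>2, 0], vector [0, 0, I\<^sub>3]]"

definition grad :: "(real^3 \<Rightarrow> real) \<Rightarrow> real^3 \<Rightarrow> real^3" where
  "grad u x = (\<chi> i. frechet_derivative u (at x) (axis i 1))"

definition d_gamma :: "((real^3) \<times> (real^3) \<Rightarrow> real) \<Rightarrow> (real^3) \<times> (real^3) \<Rightarrow> real^3" where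
  "d_gamma f = (\<lambda>(\<gamma>, K). grad (\<lambda>c. f (c, K)) \<gamma>)"

definition d_K :: "((real^3) \<times> (real^3) \<Rightarrow> real) \<Rightarrow> (real^3) \<times> (real^3) \<Rightarrow> real^3" where
  "d_K f = (\<lambda>(\<gamma>, K). grad (\<lambda>k. f (\<gamma>, k)) K)"

definition Omega :: "real \<Rightarrow> real \<Rightarrow> real^3^3 \<Rightarrow> real^3 \<Rightarrow> real^3 \<Rightarrow> real^3" where
  "Omega m r II \<gamma> K = matrix_inv II *v K -
     (m * r\<^sup>2 * ((K \<bullet> (matrix_inv II *v \<gamma>)) /
        ((norm \<gamma>)\<^sup>2 + m * r\<^sup>2 * (\<gamma> \<bullet> (matrix_inv II *v \<gamma>))))) *\<^sub>R (matrix_inv II *v \<gamma>)"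

definition rank1_bracket :: "real \<Rightarrow> real \<Rightarrow> real^3^3 \<Rightarrow> ((real^3) \<times> (real^3)) bracket" where
  "rank1_bracket m r II f g = (\<lambda>(\<gamma>, K).
     - ((K + (m * r\<^sup>2 * (Omega m r II \<gamma> K \<bullet> \<gamma>)) *\<^sub>R \<gamma>)
          \<bullet> cross3 (d_K f (\<gamma>, K)) (d_K g (\<gamma>, K)))
     - \<gamma> \<bullet> (cross3 (d_K f (\<gamma>, K)) (d_gamma g (\<gamma>, K)) - cross3 (d_K g (\<gamma>, K)) (d_gamma f (\<gamma>, K))))"

text \<open>The relation \<open>K = \<I>\<Omega> + mr\<^sup>2(\<Omega>\<cdot>\<gamma>)\<gamma>\<close> is inverted by the formula for \<open>Omega\<close> only if
  \<open>\<parallel>\<gamma>\<parallel> = 1\<close>. For arbitrary \<open>\<gamma> \<noteq> 0\<close> that formula inverts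
  \<open>K = \<I>\<Omega> + mr\<^sup>2((\<Omega>\<cdot>\<gamma>)/\<parallel>\<gamma>\<parallel>\<^sup>2)\<gamma>\<close>, in which \<open>\<Omega>\<close> is orthogonally projected to the line
  spanned by \<open>\<gamma>\<close>. The bracket with this projection in place of \<open>(\<Omega>\<cdot>\<gamma>)\<gamma>\<close> coincides with
  \<open>rank1_bracket\<close> for \<open>\<parallel>\<gamma>\<parallel> = 1\<close>. Off the unit sphere the two differ, and there
  \<open>rank1_bracket\<close> multiplied by the conformal factor violates the Jacobi identity in general.\<close>

definition rank1_bracket_extended ::
  "real \<Rightarrow> real \<Rightarrow> real^3^3 \<Rightarrow> ((real^3) \<times> (real^3)) bracket" where
  "rank1_bracket_extended m r II f g = (\<lambda>(\<gamma>, K).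
     - ((K + (m * r\<^sup>2 * ((Omega m r II \<gamma> K \<bullet> \<gamma>) / (norm \<gamma>)\<^sup>2)) *\<^sub>R \<gamma>)
          \<bullet> cross3 (d_K f (\<gamma>, K)) (d_K g (\<gamma>, K)))
     - \<gamma> \<bullet> (cross3 (d_K f (\<gamma>, K)) (d_gamma g (\<gamma>, K)) - cross3 (d_K g (\<gamma>, K)) (d_gamma f (\<gamma>, K))))"

definition rank1_factor :: "real \<Rightarrow> real \<Rightarrow> real^3^3 \<Rightarrow> (real^3) \<times> (real^3) \<Rightarrow> real" where
  "rank1_factor m r II =
     (\<lambda>(\<gamma>, K). sqrt ((norm \<gamma>)\<^sup>2 + m * r\<^sup>2 * (\<gamma> \<bullet> (matrix_inv II *v \<gamma>))))"

text \<open>At \<open>\<gamma> = 0\<close> the function \<open>\<Omega>\<close> is undefined and \<open>rank1_factor\<close> vanishes and is not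
  differentiable, so the largest domain is \<open>\<gamma> \<noteq> 0\<close>.\<close>

definition punctured_space :: "((real^3) \<times> (real^3)) set" where
  "punctured_space = {(\<gamma>, K). \<gamma> \<noteq> 0}"

text \<open>Since \<open>\<gamma> = g\<^sup>-\<^sup>1e\<^sub>3\<close> with \<open>g \<in> SO(3)\<close>, the states of the body have \<open>\<parallel>\<gamma>\<parallel> = 1\<close>.\<close>

definition phase_space :: "((real^3) \<times> (real^3)) set" where
  "phase_space = {(\<gamma>, K). norm \<gamma> = 1}"

end

theory Submission
  imports Defs
begin

text \<open>Write \<open>k = mr\<^sup>2\<close>, \<open>J = \<I>\<^sup>-\<^sup>1\<close>, \<open>N = \<parallel>\<gamma>\<parallel>\<^sup>2 + k \<gamma>\<cdot>J\<gamma>\<close> and \<open>\<phi> = \<surd>N\<close>. Both brackets are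
  \<open>-(K + \<kappa>\<gamma>)\<cdot>(f\<^sub>K \<times> g\<^sub>K) - \<gamma>\<cdot>(f\<^sub>K \<times> g\<^sub>\<gamma> - g\<^sub>K \<times> f\<^sub>\<gamma>)\<close> for some function \<open>\<kappa>\<close>, and the extended one
  has \<open>\<kappa> = k (K\<cdot>J\<gamma>)/N\<close>. By symmetry of second derivatives, the Jacobi identity for \<open>\<phi>{f,g}\<close> reduces
  to the vanishing of a trilinear expression in the differentials at each point. Since \<open>\<phi>\<^sup>2 = N\<close>, the
  factors \<open>1/\<phi>\<close> coming from \<open>d\<phi>\<close> and \<open>\<phi>\<kappa>\<close> cancel, and what remains follows from
  \<open>(Lc)\<cdot>(a \<times> b) + (La)\<cdot>(b \<times> c) + (Lb)\<cdot>(c \<times> a) = tr(L) a\<cdot>(b \<times> c)\<close>. Finally \<open>\<parallel>\<gamma>\<parallel>\<^sup>2\<close> is a Casimir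
  function for every \<open>\<kappa>\<close>, so all these brackets restrict to \<open>\<parallel>\<gamma>\<parallel> = 1\<close>, where the two in question
  agree; hence the Jacobi identity passes from the extended bracket to the original one.\<close>

section \<open>Smooth functions\<close>

text \<open>Since \<open>U\<close> is open, agreement on \<open>U\<close> is agreement near each
  point of \<open>U\<close>, so the derivatives agree on \<open>U\<close> as well and the induction
  can pass to them; hence \<open>f\<close> and \<open>g\<close> are generalised.\<close>

lemma Ck_on_cong:
  assumes "open U" "\<And>x. x \<in> U \<Longrightarrow> f x = g x" "Ck_on k U f"
  shows "Ck_on k U g"
  using assms(2,3)
proof (induction k arbitrary: f g)
  case 0
  then show ?case by (simp cong: continuous_on_cong)
next
  case (Suc k)
  have der: "(g has_derivative frechet_derivative f (at x)) (at x)" if "x \<in> U" for x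
    using Suc.prems that \<open>open U\<close>
    by (intro has_derivative_transform_within_open[of f _ x UNIV U g])
       (auto simp: frechet_derivative_works[symmetric])
  then have "frechet_derivative g (at x) = frechet_derivative f (at x)" if "x \<in> U" for x
    using frechet_derivative_at that by metis
  moreover have "g differentiable (at x)" if "x \<in> U" for x
    using der that differentiable_def by blast
  ultimately show ?case
    using Suc.IH[of "\<lambda>x. frechet_derivative f (at x) v" "\<lambda>x. frechet_derivative g (at x) v" for v]
      Suc.prems by auto
qed

lemma Ck_on_Suc_D: "Ck_on (Suc k) U f \<Longrightarrow> Ck_on k U f"
proof (induction k arbitrary: f)
  case 0
  then show ?case
    by (auto intro!: continuous_at_imp_continuous_on differentiable_imp_continuous_within)
next
  case (Suc k)
  then show ?case by (metis Ck_on.simps(2))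
qed

text \<open>Lets the closure proofs supply a derivative by the usual rules instead of computing
  \<open>frechet_derivative\<close>.\<close>

lemma Ck_on_SucI:
  assumes "open U" "\<And>x. x \<in> U \<Longrightarrow> (f has_derivative f' x) (at x)"
    and "\<And>v. Ck_on k U (\<lambda>x. f' x v)"
  shows "Ck_on (Suc k) U f"
proof -
  have "frechet_derivative f (at x) = f' x" if "x \<in> U" for x
    using assms(2) frechet_derivative_at that by metis
  then have "Ck_on k U (\<lambda>x. frechet_derivative f (at x) v)" for v
    using Ck_on_cong[OF \<open>open U\<close> _ assms(3)[of v]] by simp
  then show ?thesis
    using assms(2) by (auto simp: differentiable_def)
qed

lemma Ck_on_has_derivative:
  "Ck_on (Suc k) U f \<Longrightarrow> x \<in> U \<Longrightarrow> (f has_derivative frechet_derivative f (at x)) (at x)"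
  by (simp add: frechet_derivative_works[symmetric])

lemma Ck_on_const: "Ck_on k U (\<lambda>x. c)"
  by (induction k arbitrary: c) auto

lemma Ck_on_bounded_linear: "bounded_linear f \<Longrightarrow> Ck_on k U f"
proof (induction k)
  case 0
  then show ?case by (simp add: linear_continuous_on)
next
  case (Suc k)
  have "(f has_derivative f) (at x)" for x
    using Suc.prems by (rule bounded_linear_imp_has_derivative)
  moreover from this have "frechet_derivative f (at x) = f" for x
    using frechet_derivative_at by metis
  ultimately show ?case by (auto simp: Ck_on_const differentiable_def)
qed

lemma Ck_on_add:
  assumes "open U" "Ck_on k U f" "Ck_on k U g"
  shows "Ck_on k U (\<lambda>x. f x + g x)"
  using assms(2,3)
proof (induction k arbitrary: f g)
  case 0
  then show ?case by (simp add: continuous_on_add)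
next
  case (Suc k)
  note der = Suc.prems[THEN Ck_on_has_derivative]
  show ?case
    by (rule Ck_on_SucI[OF \<open>open U\<close>]) (use Suc in \<open>auto intro!: has_derivative_add der\<close>)
qed

lemma Ck_on_mult:
  assumes "open U" "Ck_on k U f" "Ck_on k U g"
  shows "Ck_on k U (\<lambda>x. f x * g x)"
  using assms(2,3)
proof (induction k arbitrary: f g)
  case 0
  then show ?case by (simp add: continuous_on_mult)
next
  case (Suc k)
  note der = Suc.prems[THEN Ck_on_has_derivative]
  \<comment> \<open>The product rule leaves one factor undifferentiated in each term, so both
    factors are also needed at order \<open>k\<close>.\<close>
  note low = Suc.prems[THEN Ck_on_Suc_D]
  show ?case
  proof (rule Ck_on_SucI[OF \<open>open U\<close>])
    show "((\<lambda>x. f x * g x) has_derivative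
        (\<lambda>v. f x * frechet_derivative g (at x) v + frechet_derivative f (at x) v * g x)) (at x)"
      if "x \<in> U" for x
      using der that by (intro has_derivative_mult) auto
    show "Ck_on k U (\<lambda>x. f x * frechet_derivative g (at x) v + frechet_derivative f (at x) v * g x)"
      for v
      using Suc.prems low by (auto intro!: Ck_on_add[OF \<open>open U\<close>] Suc.IH)
  qed
qed

text \<open>The derivative of \<open>1/f\<close> is built from \<open>1/f\<close> itself and the
  derivative of \<open>f\<close>, so induction on \<open>k\<close> with \<open>f\<close> fixed
  suffices.\<close>

lemma Ck_on_inverse:
  assumes "open U" "Ck_on k U f" "\<And>x. x \<in> U \<Longrightarrow> f x \<noteq> 0"
  shows "Ck_on k U (\<lambda>x. inverse (f x))"
  using assms(2)
proof (induction k)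
  case 0
  then show ?case using assms(3) by (simp add: continuous_on_inverse)
next
  case (Suc k)
  have inv: "Ck_on k U (\<lambda>x. inverse (f x))"
    using Suc Ck_on_Suc_D by blast
  show ?case
  proof (rule Ck_on_SucI[OF \<open>open U\<close>])
    show "((\<lambda>x. inverse (f x)) has_derivative
        (\<lambda>v. (-1) * (inverse (f x) * frechet_derivative f (at x) v * inverse (f x)))) (at x)"
      if "x \<in> U" for x
      using Deriv.has_derivative_inverse[OF assms(3)[OF that] Ck_on_has_derivative[OF Suc.prems that]]
      by simp
    show "Ck_on k U (\<lambda>x. (-1) * (inverse (f x) * frechet_derivative f (at x) v * inverse (f x)))" for v
      by (intro Ck_on_mult[OF \<open>open U\<close>] Ck_on_const inv) (use Suc.prems in simp)
  qed
qed

lemma Ck_on_sqrt: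
  assumes "open U" "Ck_on k U f" "\<And>x. x \<in> U \<Longrightarrow> f x > 0"
  shows "Ck_on k U (\<lambda>x. sqrt (f x))"
  using assms(2)
proof (induction k)
  case 0
  then show ?case by (simp add: continuous_on_real_sqrt)
next
  case (Suc k)
  have inv: "Ck_on k U (\<lambda>x. inverse (sqrt (f x)))"
  proof (rule Ck_on_inverse[OF \<open>open U\<close>])
    show "Ck_on k U (\<lambda>x. sqrt (f x))"
      using Suc.IH[OF Ck_on_Suc_D[OF Suc.prems]] .
    show "sqrt (f x) \<noteq> 0" if "x \<in> U" for x
      using assms(3)[OF that] by simp
  qed
  show ?case
  proof (rule Ck_on_SucI[OF \<open>open U\<close>])
    show "((\<lambda>x. sqrt (f x)) has_derivative
        (\<lambda>v. frechet_derivative f (at x) v * (inverse (sqrt (f x)) * (1/2)))) (at x)"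
      if "x \<in> U" for x
      by (rule has_derivative_eq_rhs,
          rule has_derivative_real_sqrt[OF assms(3)[OF that] Ck_on_has_derivative[OF Suc.prems that]])
         (auto simp: fun_eq_iff)
    show "Ck_on k U (\<lambda>x. frechet_derivative f (at x) v * (inverse (sqrt (f x)) * (1/2)))" for v
      by (intro Ck_on_mult[OF \<open>open U\<close>] Ck_on_const inv) (use Suc.prems in simp)
  qed
qed

lemma smooth_on_cong:
  "open U \<Longrightarrow> (\<And>x. x \<in> U \<Longrightarrow> f x = g x) \<Longrightarrow> smooth_on U f \<Longrightarrow> smooth_on U g"
  unfolding smooth_on_def using Ck_on_cong by blast

lemma smooth_on_has_derivative:
  "smooth_on U f \<Longrightarrow> x \<in> U \<Longrightarrow> (f has_derivative frechet_derivative f (at x)) (at x)"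
  unfolding smooth_on_def using Ck_on_has_derivative by blast

lemma smooth_on_differentiable: "smooth_on U f \<Longrightarrow> x \<in> U \<Longrightarrow> f differentiable (at x)"
  using smooth_on_has_derivative differentiable_def by blast

lemma smooth_on_frechet_derivative:
  "smooth_on U f \<Longrightarrow> smooth_on U (\<lambda>x. frechet_derivative f (at x) v)"
  unfolding smooth_on_def by (metis Ck_on.simps(2))

lemma smooth_on_const: "smooth_on U (\<lambda>x. c)"
  by (simp add: smooth_on_def Ck_on_const)

lemma smooth_on_bounded_linear: "bounded_linear f \<Longrightarrow> smooth_on U f"
  by (simp add: smooth_on_def Ck_on_bounded_linear)

lemma smooth_on_add:
  "open U \<Longrightarrow> smooth_on U f \<Longrightarrow> smooth_on U g \<Longrightarrow> smooth_on U (\<lambda>x. f x + g x)"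
  by (simp add: smooth_on_def Ck_on_add)

lemma smooth_on_mult:
  "open U \<Longrightarrow> smooth_on U f \<Longrightarrow> smooth_on U g \<Longrightarrow> smooth_on U (\<lambda>x. f x * g x)"
  by (simp add: smooth_on_def Ck_on_mult)

lemma smooth_on_minus: "open U \<Longrightarrow> smooth_on U f \<Longrightarrow> smooth_on U (\<lambda>x. - f x)"
  using smooth_on_mult[OF _ smooth_on_const[of U "-1"], of f] by simp

lemma smooth_on_diff:
  "open U \<Longrightarrow> smooth_on U f \<Longrightarrow> smooth_on U g \<Longrightarrow> smooth_on U (\<lambda>x. f x - g x)"
  using smooth_on_add[OF _ _ smooth_on_minus, of U f g] by simp

lemma smooth_on_divide:
  "open U \<Longrightarrow> smooth_on U f \<Longrightarrow> smooth_on U g \<Longrightarrow> (\<And>x. x \<in> U \<Longrightarrow> g x \<noteq> 0)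
    \<Longrightarrow> smooth_on U (\<lambda>x. f x / g x)"
  unfolding divide_inverse
  by (rule smooth_on_mult) (auto simp: smooth_on_def Ck_on_inverse)

lemma smooth_on_sqrt:
  "open U \<Longrightarrow> smooth_on U f \<Longrightarrow> (\<And>x. x \<in> U \<Longrightarrow> f x > 0) \<Longrightarrow> smooth_on U (\<lambda>x. sqrt (f x))"
  by (simp add: smooth_on_def Ck_on_sqrt)

lemma smooth_on_sum:
  assumes "open U" "\<And>i. i \<in> A \<Longrightarrow> smooth_on U (f i)"
  shows "smooth_on U (\<lambda>x. \<Sum>i\<in>A. f i x)"
  using assms(2)
  by (induction A rule: infinite_finite_induct) (auto intro: smooth_on_const smooth_on_add[OF \<open>open U\<close>])

text \<open>\<open>smooth_on\<close> concerns real-valued functions, so the inner product is split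
  into products of linear coordinates. This yields the quadratic expressions in \<gamma> and
  \<open>K\<close> that occur later.\<close>

lemma smooth_on_inner_bounded_linear:
  fixes f g :: "'a::real_normed_vector \<Rightarrow> 'b::euclidean_space"
  assumes "open U" "bounded_linear f" "bounded_linear g"
  shows "smooth_on U (\<lambda>x. f x \<bullet> g x)"
proof -
  have "smooth_on U (\<lambda>x. h x \<bullet> i)" if "bounded_linear h" for h :: "'a \<Rightarrow> 'b" and i
    using that by (intro smooth_on_bounded_linear bounded_linear_inner_left_comp)
  then have "smooth_on U (\<lambda>x. \<Sum>i\<in>Basis. (f x \<bullet> i) * (g x \<bullet> i))"
    using assms by (auto intro!: smooth_on_sum smooth_on_mult)
  then show ?thesis
    by (simp add: euclidean_inner[symmetric])
qed

lemmas smooth_on_intros = smooth_on_const smooth_on_add smooth_on_mult smooth_on_minus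
  smooth_on_diff smooth_on_divide smooth_on_sqrt smooth_on_sum

section \<open>Symmetry of second derivatives\<close>

lemma has_real_derivative_along_line:
  assumes "(f has_derivative f') (at (x + s *\<^sub>R v))"
  shows "((\<lambda>t. f (x + t *\<^sub>R v)) has_real_derivative f' v) (at s)"
proof -
  have "((\<lambda>t. x + t *\<^sub>R v) has_derivative (\<lambda>t. t *\<^sub>R v)) (at s)"
    by (auto intro!: derivative_eq_intros)
  from diff_chain_at[OF this assms]
  have "((\<lambda>t. f (x + t *\<^sub>R v)) has_derivative (\<lambda>t. f' (t *\<^sub>R v))) (at s)"
    by (simp add: o_def)
  then show ?thesis
    unfolding has_field_derivative_def
    by (rule has_derivative_eq_rhs)
       (simp add: fun_eq_iff linear_cmul[OF has_derivative_linear[OF assms]])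
qed

text \<open>Two applications of the mean value theorem: in \<open>s\<close> to the difference of
  \<open>f\<close> along two parallel segments in direction \<open>v\<close>, then in
  \<open>t\<close> to the resulting derivative in direction \<open>v\<close>.\<close>

lemma second_difference_mean_value:
  fixes f :: "'a::real_normed_vector \<Rightarrow> real"
  assumes "smooth_on U f" "0 < e"
    and inU: "\<And>s t. 0 \<le> s \<Longrightarrow> s \<le> e \<Longrightarrow> 0 \<le> t \<Longrightarrow> t \<le> e \<Longrightarrow> x + s *\<^sub>R v + t *\<^sub>R w \<in> U"
  obtains s t where "0 < s" "s < e" "0 < t" "t < e"
    and "f (x + e *\<^sub>R v + e *\<^sub>R w) - f (x + e *\<^sub>R v) - f (x + e *\<^sub>R w) + f x =
      e * e * frechet_derivative (\<lambda>y. frechet_derivative f (at y) v) (at (x + s *\<^sub>R v + t *\<^sub>R w)) w"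
proof -
  let ?D = "\<lambda>y. frechet_derivative f (at y) v"
  have 1: "((\<lambda>s. f (x + s *\<^sub>R v + e *\<^sub>R w) - f (x + s *\<^sub>R v)) has_real_derivative
      ?D (x + s *\<^sub>R v + e *\<^sub>R w) - ?D (x + s *\<^sub>R v)) (at s)" if "0 \<le> s" "s \<le> e" for s
  proof -
    have "((\<lambda>s. f ((x + e *\<^sub>R w) + s *\<^sub>R v)) has_real_derivative ?D ((x + e *\<^sub>R w) + s *\<^sub>R v)) (at s)"
      using inU[OF that, of e] \<open>0 < e\<close> assms(1)
      by (intro has_real_derivative_along_line smooth_on_has_derivative) (auto simp: algebra_simps)
    moreover have "((\<lambda>s. f (x + s *\<^sub>R v)) has_real_derivative ?D (x + s *\<^sub>R v)) (at s)"
      using inU[OF that, of 0] \<open>0 < e\<close> assms(1)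
      by (intro has_real_derivative_along_line smooth_on_has_derivative) auto
    ultimately show ?thesis
      using DERIV_diff by (fastforce simp: add_ac)
  qed
  obtain s where s: "0 < s" "s < e" and fs:
    "f (x + e *\<^sub>R v + e *\<^sub>R w) - f (x + e *\<^sub>R v) - (f (x + 0 *\<^sub>R v + e *\<^sub>R w) - f (x + 0 *\<^sub>R v))
      = (e - 0) * (?D (x + s *\<^sub>R v + e *\<^sub>R w) - ?D (x + s *\<^sub>R v))"
    using MVT2[OF \<open>0 < e\<close> 1] by auto
  have 2: "((\<lambda>t. ?D (x + s *\<^sub>R v + t *\<^sub>R w)) has_real_derivative
      frechet_derivative ?D (at (x + s *\<^sub>R v + t *\<^sub>R w)) w) (at t)" if "0 \<le> t" "t \<le> e" for t
    using inU[of s t] s that smooth_on_frechet_derivative[OF assms(1), of v]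
    by (intro has_real_derivative_along_line smooth_on_has_derivative) auto
  obtain t where t: "0 < t" "t < e" and
    "?D (x + s *\<^sub>R v + e *\<^sub>R w) - ?D (x + s *\<^sub>R v + 0 *\<^sub>R w)
      = (e - 0) * frechet_derivative ?D (at (x + s *\<^sub>R v + t *\<^sub>R w)) w"
    using MVT2[OF \<open>0 < e\<close> 2] by auto
  then show thesis
    using that[OF s t] fs by (simp add: algebra_simps)
qed

lemma second_difference_tendsto:
  fixes f :: "'a::real_normed_vector \<Rightarrow> real"
  assumes "open U" "smooth_on U f" "x \<in> U"
  shows "((\<lambda>e. (f (x + e *\<^sub>R v + e *\<^sub>R w) - f (x + e *\<^sub>R v) - f (x + e *\<^sub>R w) + f x) / (e * e))
    \<longlongrightarrow> frechet_derivative (\<lambda>y. frechet_derivative f (at y) v) (at x) w) (at_right 0)"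
proof (rule tendstoI)
  fix \<epsilon> :: real assume "0 < \<epsilon>"
  let ?H = "\<lambda>y. frechet_derivative (\<lambda>y. frechet_derivative f (at y) v) (at y) w"
  have "continuous_on U ?H"
    using smooth_on_frechet_derivative[OF smooth_on_frechet_derivative[OF assms(2)]]
    unfolding smooth_on_def by (metis Ck_on.simps(1))
  then have "isCont ?H x"
    using assms continuous_on_eq_continuous_at by blast
  then obtain \<delta>1 where "0 < \<delta>1" and \<delta>1: "\<And>y. dist y x < \<delta>1 \<Longrightarrow> dist (?H y) (?H x) < \<epsilon>"
    using \<open>0 < \<epsilon>\<close> unfolding continuous_at_eps_delta by (metis dist_commute)
  obtain \<delta>2 where "0 < \<delta>2" and \<delta>2: "ball x \<delta>2 \<subseteq> U"
    using assms open_contains_ball by blast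
  define \<delta> where "\<delta> = min \<delta>1 \<delta>2"
  \<comment> \<open>Chosen so that all points with parameters at most \<open>e < e0\<close> stay
    within \<delta> of \<open>x\<close>; the summand 1 keeps the denominator positive if
    \<open>v\<close> and \<open>w\<close> both vanish.\<close>
  define e0 where "e0 = \<delta> / (norm v + norm w + 1)"
  have pos: "0 < norm v + norm w + 1"
    by (simp add: add_nonneg_pos)
  have "0 < \<delta>" using \<open>0 < \<delta>1\<close> \<open>0 < \<delta>2\<close> by (simp add: \<delta>_def)
  then have "0 < e0" using pos by (simp add: e0_def)
  have near: "dist (x + s *\<^sub>R v + t *\<^sub>R w) x < \<delta>" if "0 \<le> s" "s \<le> e" "0 \<le> t" "t \<le> e" "e < e0" for s t e
  proof -
    have "dist (x + s *\<^sub>R v + t *\<^sub>R w) x = norm (s *\<^sub>R v + t *\<^sub>R w)"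
      by (simp add: dist_norm)
    also have "\<dots> \<le> s * norm v + t * norm w"
      using that by (intro norm_triangle_le) simp
    also have "\<dots> \<le> e * norm v + e * norm w"
      using that by (intro add_mono mult_right_mono) auto
    also have "\<dots> \<le> e * (norm v + norm w + 1)"
      using that by (simp add: algebra_simps)
    also have "\<dots> < e0 * (norm v + norm w + 1)"
      using that pos by (intro mult_strict_right_mono) auto
    finally show ?thesis using pos by (simp add: e0_def)
  qed
  have "dist ((f (x + e *\<^sub>R v + e *\<^sub>R w) - f (x + e *\<^sub>R v) - f (x + e *\<^sub>R w) + f x) / (e * e)) (?H x) < \<epsilon>"
    if "0 < e" "e < e0" for e
  proof -
    have "x + s *\<^sub>R v + t *\<^sub>R w \<in> U" if "0 \<le> s" "s \<le> e" "0 \<le> t" "t \<le> e" for s t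
      using near[OF that \<open>e < e0\<close>] \<delta>2 by (auto simp: \<delta>_def dist_commute)
    from second_difference_mean_value[OF assms(2) \<open>0 < e\<close> this]
    obtain s t where "0 < s" "s < e" "0 < t" "t < e"
      and eq: "f (x + e *\<^sub>R v + e *\<^sub>R w) - f (x + e *\<^sub>R v) - f (x + e *\<^sub>R w) + f x =
        e * e * ?H (x + s *\<^sub>R v + t *\<^sub>R w)"
      by blast
    then show ?thesis
      using \<delta>1[of "x + s *\<^sub>R v + t *\<^sub>R w"] near[of s e t] that by (simp add: \<delta>_def)
  qed
  then show "\<forall>\<^sub>F e in at_right 0. dist ((f (x + e *\<^sub>R v + e *\<^sub>R w) - f (x + e *\<^sub>R v) - f (x + e *\<^sub>R w) + f x)
      / (e * e)) (?H x) < \<epsilon>"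
    using \<open>0 < e0\<close> by (auto simp: eventually_at_right_field)
qed

text \<open>The second difference quotient is symmetric in \<open>v\<close> and \<open>w\<close>, so
  its limit can be read off in both orders.\<close>

lemma mixed_derivatives_commute:
  fixes f :: "'a::real_normed_vector \<Rightarrow> real"
  assumes "open U" "smooth_on U f" "x \<in> U"
  shows "frechet_derivative (\<lambda>y. frechet_derivative f (at y) v) (at x) w =
    frechet_derivative (\<lambda>y. frechet_derivative f (at y) w) (at x) v"
proof (rule tendsto_unique[OF trivial_limit_at_right_real])
  show "((\<lambda>e. (f (x + e *\<^sub>R v + e *\<^sub>R w) - f (x + e *\<^sub>R v) - f (x + e *\<^sub>R w) + f x) / (e * e))
    \<longlongrightarrow> frechet_derivative (\<lambda>y. frechet_derivative f (at y) v) (at x) w) (at_right 0)"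
    using assms by (rule second_difference_tendsto)
  show "((\<lambda>e. (f (x + e *\<^sub>R v + e *\<^sub>R w) - f (x + e *\<^sub>R v) - f (x + e *\<^sub>R w) + f x) / (e * e))
    \<longlongrightarrow> frechet_derivative (\<lambda>y. frechet_derivative f (at y) w) (at x) v) (at_right 0)"
    using second_difference_tendsto[OF assms, of w v] by (simp add: algebra_simps)
qed

section \<open>Gradients with respect to the inner product\<close>

definition total_grad :: "('a::euclidean_space \<Rightarrow> real) \<Rightarrow> 'a \<Rightarrow> 'a" where
  "total_grad f x = (\<Sum>i\<in>Basis. frechet_derivative f (at x) i *\<^sub>R i)"

lemma total_grad_inner_Basis: "i \<in> Basis \<Longrightarrow> total_grad f x \<bullet> i = frechet_derivative f (at x) i"
  by (simp add: total_grad_def inner_sum_left_Basis)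

lemma total_grad_inner:
  assumes "f differentiable (at x)"
  shows "total_grad f x \<bullet> w = frechet_derivative f (at x) w"
proof -
  have lin: "linear (frechet_derivative f (at x))"
    using assms by (rule linear_frechet_derivative)
  have "frechet_derivative f (at x) w = frechet_derivative f (at x) (\<Sum>i\<in>Basis. (w \<bullet> i) *\<^sub>R i)"
    by (simp add: euclidean_representation)
  also have "\<dots> = (\<Sum>i\<in>Basis. (w \<bullet> i) * frechet_derivative f (at x) i)"
    by (simp add: linear_sum[OF lin] linear_cmul[OF lin])
  finally show ?thesis
    by (simp add: total_grad_def inner_sum_left inner_sum_right inner_commute[of _ w] mult.commute)
qed

lemma total_grad_eqI:
  assumes "(f has_derivative f') (at x)" "\<And>w. f' w = v \<bullet> w"
  shows "total_grad f x = v"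
proof -
  have "frechet_derivative f (at x) = f'"
    using assms(1) frechet_derivative_at by metis
  then have "total_grad f x \<bullet> w = v \<bullet> w" for w
    using total_grad_inner[of f x w] assms by (auto simp: differentiable_def)
  then show ?thesis
    using vector_eq_rdot by blast
qed

lemma has_derivative_total_grad:
  assumes "smooth_on U f" "x \<in> U"
  shows "(f has_derivative (\<lambda>w. total_grad f x \<bullet> w)) (at x)"
  using smooth_on_has_derivative[OF assms] total_grad_inner[OF smooth_on_differentiable[OF assms]]
  by simp

section \<open>Almost Poisson brackets\<close>

text \<open>Linearity in the second argument is obtained from linearity in the first by skew
  symmetry.\<close>

lemma almost_poisson_bracketI:
  assumes "\<And>f g. smooth_on U f \<Longrightarrow> smooth_on U g \<Longrightarrow> smooth_on U (B f g)"
    and "\<And>f g h a b x. smooth_on U f \<Longrightarrow> smooth_on U g \<Longrightarrow> smooth_on U h \<Longrightarrow> x \<in> U \<Longrightarrow>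
      B (\<lambda>y. a * f y + b * g y) h x = a * B f h x + b * B g h x"
    and "\<And>f g x. smooth_on U f \<Longrightarrow> smooth_on U g \<Longrightarrow> x \<in> U \<Longrightarrow> B f g x = - B g f x"
    and "\<And>f g h x. smooth_on U f \<Longrightarrow> smooth_on U g \<Longrightarrow> smooth_on U h \<Longrightarrow> x \<in> U \<Longrightarrow>
      B (\<lambda>y. f y * g y) h x = f x * B g h x + g x * B f h x"
    and "\<And>f g x. smooth_on U f \<Longrightarrow> smooth_on U g \<Longrightarrow> (\<And>x. x \<in> M \<Longrightarrow> f x = 0) \<Longrightarrow> x \<in> M
      \<Longrightarrow> B f g x = 0"
    and "open U"
  shows "almost_poisson_bracket U M B"
proof -
  have "B h (\<lambda>y. a * f y + b * g y) x = a * B h f x + b * B h g x"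
    if "smooth_on U f" "smooth_on U g" "smooth_on U h" "x \<in> U" for f g h a b x
  proof -
    have "smooth_on U (\<lambda>y. a * f y + b * g y)"
      using that \<open>open U\<close> by (intro smooth_on_intros)
    then show ?thesis
      using assms(2)[OF that, of a b] assms(3)[of h _ x] that by simp
  qed
  then show ?thesis
    unfolding almost_poisson_bracket_def restricts_to_def
    by (intro conjI allI impI ballI assms(1-5)) blast+
qed

context
  fixes U M :: "'a::real_normed_vector set" and B :: "'a bracket"
  assumes B: "almost_poisson_bracket U M B"
begin

lemma almost_poisson_smooth: "smooth_on U f \<Longrightarrow> smooth_on U g \<Longrightarrow> smooth_on U (B f g)"
  using B by (simp add: almost_poisson_bracket_def)

lemma almost_poisson_linear:
  "smooth_on U f \<Longrightarrow> smooth_on U g \<Longrightarrow> smooth_on U h \<Longrightarrow> x \<in> U \<Longrightarrow>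
    B (\<lambda>y. a * f y + b * g y) h x = a * B f h x + b * B g h x"
  using B unfolding almost_poisson_bracket_def by blast

lemma almost_poisson_skew:
  "smooth_on U f \<Longrightarrow> smooth_on U g \<Longrightarrow> x \<in> U \<Longrightarrow> B f g x = - B g f x"
  using B unfolding almost_poisson_bracket_def by blast

lemma almost_poisson_Leibniz:
  "smooth_on U f \<Longrightarrow> smooth_on U g \<Longrightarrow> smooth_on U h \<Longrightarrow> x \<in> U \<Longrightarrow>
    B (\<lambda>y. f y * g y) h x = f x * B g h x + g x * B f h x"
  using B unfolding almost_poisson_bracket_def by blast

lemma almost_poisson_vanish:
  "smooth_on U f \<Longrightarrow> smooth_on U g \<Longrightarrow> (\<And>x. x \<in> M \<Longrightarrow> f x = 0) \<Longrightarrow> x \<in> M \<Longrightarrow> B f g x = 0"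
  using B by (simp add: almost_poisson_bracket_def restricts_to_def)

end

text \<open>Agreement is asked for smooth arguments only, because the partial gradients in the rank
  one brackets are identified with \<open>total_grad\<close> only where the functions are
  differentiable.\<close>

lemma almost_poisson_bracket_cong:
  assumes "open U" "M \<subseteq> U" "almost_poisson_bracket U M B'"
    and eq: "\<And>f g x. smooth_on U f \<Longrightarrow> smooth_on U g \<Longrightarrow> x \<in> U \<Longrightarrow> B f g x = B' f g x"
  shows "almost_poisson_bracket U M B"
proof (rule almost_poisson_bracketI)
  show "smooth_on U (B f g)" if "smooth_on U f" "smooth_on U g" for f g
    using smooth_on_cong[OF \<open>open U\<close> _ almost_poisson_smooth[OF assms(3) that]] eq[OF that] by simp
  show "B (\<lambda>y. a * f y + b * g y) h x = a * B f h x + b * B g h x"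
    if "smooth_on U f" "smooth_on U g" "smooth_on U h" "x \<in> U" for f g h a b x
  proof -
    have "smooth_on U (\<lambda>y. a * f y + b * g y)"
      using that \<open>open U\<close> by (intro smooth_on_intros)
    then show ?thesis
      using almost_poisson_linear[OF assms(3) that] that by (simp add: eq)
  qed
  show "B f g x = - B g f x" if "smooth_on U f" "smooth_on U g" "x \<in> U" for f g x
    using almost_poisson_skew[OF assms(3) that] eq[OF that] eq[OF that(2,1,3)] by simp
  show "B (\<lambda>y. f y * g y) h x = f x * B g h x + g x * B f h x"
    if "smooth_on U f" "smooth_on U g" "smooth_on U h" "x \<in> U" for f g h x
    using almost_poisson_Leibniz[OF assms(3) that] that smooth_on_mult[OF \<open>open U\<close> that(1,2)]
    by (simp add: eq)
  show "B f g x = 0"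
    if "smooth_on U f" "smooth_on U g" "\<And>x. x \<in> M \<Longrightarrow> f x = 0" "x \<in> M" for f g x
    using almost_poisson_vanish[OF assms(3) that(1,2) _ that(4)] eq[OF that(1,2)] that \<open>M \<subseteq> U\<close> by auto
qed (fact \<open>open U\<close>)

lemma almost_poisson_bracket_restrict:
  "almost_poisson_bracket U U B \<Longrightarrow> restricts_to U M B \<Longrightarrow> almost_poisson_bracket U M B"
  unfolding almost_poisson_bracket_def by (elim conjE, intro conjI)

lemma almost_poisson_bracket_scale:
  assumes "open U" "smooth_on U \<phi>" and B: "almost_poisson_bracket U M B"
  shows "almost_poisson_bracket U M (\<lambda>f g x. \<phi> x * B f g x)"
proof (rule almost_poisson_bracketI)
  show "smooth_on U (\<lambda>x. \<phi> x * B f g x)" if "smooth_on U f" "smooth_on U g" for f g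
    using assms(1,2) almost_poisson_smooth[OF B that] by (rule smooth_on_mult)
  show "\<phi> x * B (\<lambda>y. a * f y + b * g y) h x = a * (\<phi> x * B f h x) + b * (\<phi> x * B g h x)"
    if "smooth_on U f" "smooth_on U g" "smooth_on U h" "x \<in> U" for f g h a b x
    unfolding almost_poisson_linear[OF B that] by (simp add: algebra_simps)
  show "\<phi> x * B f g x = - (\<phi> x * B g f x)" if "smooth_on U f" "smooth_on U g" "x \<in> U" for f g x
    using almost_poisson_skew[OF B that] by simp
  show "\<phi> x * B (\<lambda>y. f y * g y) h x = f x * (\<phi> x * B g h x) + g x * (\<phi> x * B f h x)"
    if "smooth_on U f" "smooth_on U g" "smooth_on U h" "x \<in> U" for f g h x
    unfolding almost_poisson_Leibniz[OF B that] by (simp add: algebra_simps)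
  show "\<phi> x * B f g x = 0"
    if "smooth_on U f" "smooth_on U g" "\<And>x. x \<in> M \<Longrightarrow> f x = 0" "x \<in> M" for f g x
    using almost_poisson_vanish[OF B that] by simp
qed (fact \<open>open U\<close>)

text \<open>On \<open>M\<close> the value \<open>{f,g}\<close> depends only on \<open>f\<close> restricted to \<open>M\<close>, so iterated brackets
  of brackets agreeing on \<open>M\<close> agree on \<open>M\<close>.\<close>

lemma jacobi_identity_cong:
  assumes "open U" "M \<subseteq> U" "almost_poisson_bracket U M B" "almost_poisson_bracket U M B'"
    and eq: "\<And>f g x. smooth_on U f \<Longrightarrow> smooth_on U g \<Longrightarrow> x \<in> M \<Longrightarrow> B f g x = B' f g x"
    and "jacobi_identity U M B'"
  shows "jacobi_identity U M B"
proof -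
  have "B (B f g) h x = B' (B' f g) h x"
    if "smooth_on U f" "smooth_on U g" "smooth_on U h" "x \<in> M" for f g h x
  proof -
    have sm: "smooth_on U (B f g)" "smooth_on U (B' f g)"
      using almost_poisson_smooth assms(3,4) that by metis+
    \<comment> \<open>The difference of the two inner brackets, written as a linear combination to
      fit \<open>almost_poisson_linear\<close>; it vanishes on \<open>M\<close>, but in general not
      off \<open>M\<close>.\<close>
    let ?d = "\<lambda>y. 1 * B f g y + (-1) * B' f g y"
    have "smooth_on U ?d"
      by (intro smooth_on_intros \<open>open U\<close> sm)
    then have "B' ?d h x = 0"
      by (rule almost_poisson_vanish[OF assms(4)]) (use eq that in auto)
    moreover have "B' ?d h x = 1 * B' (B f g) h x + (-1) * B' (B' f g) h x"
      using that \<open>M \<subseteq> U\<close> by (intro almost_poisson_linear[OF assms(4) sm]) auto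
    ultimately show ?thesis
      using eq[OF sm(1) that(3,4)] by simp
  qed
  then show ?thesis
    using assms(6) unfolding jacobi_identity_def by simp
qed

section \<open>Brackets given by a bivector field\<close>

text \<open>\<open>P x\<close> acts on covectors, which the inner product identifies with
  vectors.\<close>

definition bivector_bracket :: "('a \<Rightarrow> 'a \<Rightarrow> 'a \<Rightarrow> real) \<Rightarrow> 'a::euclidean_space bracket" where
  "bivector_bracket P f g x = P x (total_grad f x) (total_grad g x)"

text \<open>Smoothness is required for constant arguments only; expansion in the basis carries it
  over to varying gradients.\<close>

locale smooth_bivector =
  fixes U :: "'a::euclidean_space set" and P :: "'a \<Rightarrow> 'a \<Rightarrow> 'a \<Rightarrow> real"
  assumes open_U: "open U"
    and bilinear: "bilinear (P x)"
    and skew: "P x a b = - P x b a"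
    and smooth: "smooth_on U (\<lambda>x. P x a b)"
begin

lemma expand: "P x a b = (\<Sum>i\<in>Basis. \<Sum>j\<in>Basis. (a \<bullet> i) * (b \<bullet> j) * P x i j)"
proof -
  have "P x a b = P x (\<Sum>i\<in>Basis. (a \<bullet> i) *\<^sub>R i) (\<Sum>j\<in>Basis. (b \<bullet> j) *\<^sub>R j)"
    by (simp add: euclidean_representation)
  also have "\<dots> = (\<Sum>i\<in>Basis. \<Sum>j\<in>Basis. (a \<bullet> i) * (b \<bullet> j) * P x i j)"
    by (simp add: bilinear_sum[OF bilinear] sum.cartesian_product bilinear_lmul[OF bilinear]
        bilinear_rmul[OF bilinear] case_prod_beta mult_ac)
  finally show ?thesis .
qed

lemma bracket_expand:
  "bivector_bracket P f g x =
    (\<Sum>i\<in>Basis. \<Sum>j\<in>Basis. frechet_derivative f (at x) i * frechet_derivative g (at x) j * P x i j)"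
  unfolding bivector_bracket_def by (subst expand) (simp add: total_grad_inner_Basis)

lemma smooth_bracket:
  assumes "smooth_on U f" "smooth_on U g"
  shows "smooth_on U (bivector_bracket P f g)"
  unfolding bracket_expand[abs_def]
  by (intro smooth_on_sum smooth_on_mult smooth_on_frechet_derivative smooth open_U assms)

lemma almost_poisson: "almost_poisson_bracket U U (bivector_bracket P)"
proof -
  have "total_grad (\<lambda>y. a * f y + b * g y) x = a *\<^sub>R total_grad f x + b *\<^sub>R total_grad g x"
    if "smooth_on U f" "smooth_on U g" "x \<in> U" for f g :: "'a \<Rightarrow> real" and a b x
    by (rule total_grad_eqI) (use that in \<open>auto intro!: derivative_eq_intros has_derivative_total_grad
        simp: inner_add_left\<close>)
  moreover have "total_grad (\<lambda>y. f y * g y) x = f x *\<^sub>R total_grad g x + g x *\<^sub>R total_grad f x"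
    if "smooth_on U f" "smooth_on U g" "x \<in> U" for f g :: "'a \<Rightarrow> real" and x
    by (rule total_grad_eqI) (use that in \<open>auto intro!: derivative_eq_intros has_derivative_total_grad
        simp: inner_add_left\<close>)
  \<comment> \<open>With \<open>M = U\<close> the restriction condition is locality: a function
    vanishing on an open set has zero gradient there.\<close>
  moreover have "total_grad f x = 0" if "\<forall>x\<in>U. f x = 0" "x \<in> U" for f :: "'a \<Rightarrow> real" and x
  proof (rule total_grad_eqI)
    show "(f has_derivative (\<lambda>w. 0)) (at x)"
      by (rule has_derivative_transform_within_open[OF has_derivative_const open_U]) (use that in auto)
  qed simp
  ultimately show ?thesis
    by (intro almost_poisson_bracketI smooth_bracket open_U)
       (auto simp: bivector_bracket_def bilinear_ladd[OF bilinear] bilinear_lmul[OF bilinear]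
        bilinear_lzero[OF bilinear] intro: skew)
qed

section \<open>Hamiltonian vector fields, Hessians and the Jacobi criterion\<close>

text \<open>Contraction in the second slot: \<open>sharp x (total_grad h x)\<close> is the
  Hamiltonian vector of \<open>h\<close>, along which the derivative of \<open>f\<close> is
  \<open>{f,h}\<close>.\<close>

definition sharp :: "'a \<Rightarrow> 'a \<Rightarrow> 'a" where
  "sharp x c = (\<Sum>i\<in>Basis. P x i c *\<^sub>R i)"

lemma inner_sharp: "a \<bullet> sharp x c = P x a c"
proof -
  have lin: "linear (\<lambda>a. P x a c)"
    using bilinear[of x] by (simp add: bilinear_def)
  have "P x a c = P x (\<Sum>i\<in>Basis. (a \<bullet> i) *\<^sub>R i) c"
    by (simp add: euclidean_representation)
  also have "\<dots> = (\<Sum>i\<in>Basis. (a \<bullet> i) * P x i c)"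
    by (simp add: linear_sum[OF lin] linear_cmul[OF lin] del: euclidean_representation)
  finally show ?thesis
    by (simp add: sharp_def inner_sum_right mult.commute)
qed

definition hess :: "('a \<Rightarrow> real) \<Rightarrow> 'a \<Rightarrow> 'a \<Rightarrow> 'a" where
  "hess f x w = (\<Sum>i\<in>Basis.
     frechet_derivative (\<lambda>y. frechet_derivative f (at y) i) (at x) w *\<^sub>R i)"

lemma hess_inner_Basis:
  "i \<in> Basis \<Longrightarrow>
    hess f x w \<bullet> i = frechet_derivative (\<lambda>y. frechet_derivative f (at y) i) (at x) w"
  by (simp add: hess_def inner_sum_left_Basis)

lemma hess_symmetric:
  assumes "smooth_on U f" "x \<in> U"
  shows "hess f x v \<bullet> w = hess f x w \<bullet> v"
proof -
  let ?H = "\<lambda>v w. frechet_derivative (\<lambda>y. frechet_derivative f (at y) v) (at x) w"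
  have expand_hess: "hess f x v \<bullet> w = (\<Sum>i\<in>Basis. \<Sum>j\<in>Basis. (w \<bullet> i) * (v \<bullet> j) * ?H i j)" for v w
  proof -
    have "hess f x v \<bullet> w = (\<Sum>i\<in>Basis. (w \<bullet> i) * ?H i v)"
      by (simp add: hess_def inner_sum_left inner_sum_right inner_commute[of _ w] mult.commute)
    moreover have "?H i v = (\<Sum>j\<in>Basis. (v \<bullet> j) * ?H i j)" for i
    proof -
      have "?H i v = total_grad (\<lambda>y. frechet_derivative f (at y) i) x \<bullet> v"
        by (subst total_grad_inner)
          (use smooth_on_differentiable[OF smooth_on_frechet_derivative[OF assms(1)] assms(2)] in auto)
      then show ?thesis
        by (simp add: total_grad_def inner_sum_left inner_sum_right inner_commute[of _ v] mult.commute)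
    qed
    ultimately show ?thesis
      by (simp add: sum_distrib_left mult.assoc)
  qed
  show ?thesis
    unfolding expand_hess
    by (subst sum.swap, intro sum.cong refl, subst mixed_derivatives_commute[OF open_U assms])
       (simp only: mult.commute mult.left_commute)
qed

text \<open>Product rule: each gradient contributes its Hessian, and the last term differentiates
  \<open>P\<close> with both gradients frozen at \<open>x\<close>.\<close>

lemma bracket_has_derivative:
  assumes "smooth_on U f" "smooth_on U g" "x \<in> U"
  shows "(bivector_bracket P f g has_derivative (\<lambda>w.
      P x (hess f x w) (total_grad g x) + P x (total_grad f x) (hess g x w) +
      frechet_derivative (\<lambda>y. P y (total_grad f x) (total_grad g x)) (at x) w)) (at x)"
proof -
  let ?T = "\<lambda>a b. frechet_derivative (\<lambda>y. P y a b) (at x)"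
  have dP: "((\<lambda>y. P y a b) has_derivative ?T a b) (at x)" for a b
    using smooth assms(3) by (rule smooth_on_has_derivative)
  have dD: "((\<lambda>y. frechet_derivative h (at y) i) has_derivative
      frechet_derivative (\<lambda>y. frechet_derivative h (at y) i) (at x)) (at x)"
    if "smooth_on U h" for h and i :: 'a
    using smooth_on_frechet_derivative[OF that] assms(3) by (rule smooth_on_has_derivative)
  have T_expand: "?T a b w = (\<Sum>i\<in>Basis. \<Sum>j\<in>Basis. (a \<bullet> i) * (b \<bullet> j) * ?T i j w)" for a b w
  proof -
    have "((\<lambda>y. P y a b) has_derivative
        (\<lambda>w. \<Sum>i\<in>Basis. \<Sum>j\<in>Basis. (a \<bullet> i) * (b \<bullet> j) * ?T i j w)) (at x)"
      unfolding expand[of _ a b] by (intro has_derivative_sum has_derivative_mult_right dP)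
    from fun_cong[OF frechet_derivative_at[OF this], of w] show ?thesis
      by (rule sym)
  qed
  let ?D = "\<lambda>h i. frechet_derivative h (at x) i"
  let ?H = "\<lambda>h i. frechet_derivative (\<lambda>y. frechet_derivative h (at y) i) (at x)"
  have "(bivector_bracket P f g has_derivative (\<lambda>w. \<Sum>i\<in>Basis. \<Sum>j\<in>Basis.
      (?D f i * ?D g j) * ?T i j w + (?D f i * ?H g j w + ?H f i w * ?D g j) * P x i j)) (at x)"
    unfolding bracket_expand[abs_def]
    by (intro has_derivative_sum has_derivative_mult dP dD[OF assms(1)] dD[OF assms(2)])
  moreover have "(\<Sum>i\<in>Basis. \<Sum>j\<in>Basis.
      (?D f i * ?D g j) * ?T i j w + (?D f i * ?H g j w + ?H f i w * ?D g j) * P x i j) =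
    P x (hess f x w) (total_grad g x) + P x (total_grad f x) (hess g x w) +
      ?T (total_grad f x) (total_grad g x) w" for w
    unfolding T_expand[of "total_grad f x" "total_grad g x"] expand[of x "hess f x w"]
      expand[of x "total_grad f x"]
    by (simp add: total_grad_inner_Basis hess_inner_Basis sum.distrib algebra_simps)
  ultimately show ?thesis
    by simp
qed

text \<open>\<open>{{f,g},h}\<close> is the derivative of \<open>{f,g}\<close> along the Hamiltonian
  vector of \<open>h\<close>. In the cyclic sum the Hessian terms cancel in pairs by
  \<open>hess_symmetric\<close>; what is left is tensorial in the three gradients and is the
  hypothesis \<open>cyc\<close>, the vanishing of the Schouten bracket of \<open>P\<close> with
  itself.\<close>

lemma jacobi:
  assumes "M \<subseteq> U"
    and cyc: "\<And>x a b c. x \<in> M \<Longrightarrow>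
      frechet_derivative (\<lambda>y. P y a b) (at x) (sharp x c) +
      frechet_derivative (\<lambda>y. P y b c) (at x) (sharp x a) +
      frechet_derivative (\<lambda>y. P y c a) (at x) (sharp x b) = 0"
  shows "jacobi_identity U M (bivector_bracket P)"
  unfolding jacobi_identity_def
proof (intro allI impI ballI, elim conjE)
  fix f g h x
  assume sm: "smooth_on U f" "smooth_on U g" "smooth_on U h" and "x \<in> M"
  then have "x \<in> U" using assms(1) by auto
  have iter: "bivector_bracket P (bivector_bracket P f g) h x =
      hess f x (sharp x (total_grad h x)) \<bullet> sharp x (total_grad g x)
      - hess g x (sharp x (total_grad h x)) \<bullet> sharp x (total_grad f x) +
      frechet_derivative (\<lambda>y. P y (total_grad f x) (total_grad g x)) (at x) (sharp x (total_grad h x))"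
    if "smooth_on U f" "smooth_on U g" for f g h
  proof -
    note der = bracket_has_derivative[OF that \<open>x \<in> U\<close>]
    have "bivector_bracket P (bivector_bracket P f g) h x =
        total_grad (bivector_bracket P f g) x \<bullet> sharp x (total_grad h x)"
      by (simp add: bivector_bracket_def inner_sharp)
    also have "\<dots> = frechet_derivative (bivector_bracket P f g) (at x) (sharp x (total_grad h x))"
      using der by (intro total_grad_inner) (auto simp: differentiable_def)
    finally show ?thesis
      unfolding frechet_derivative_at[OF der, symmetric]
      using skew[of x "total_grad f x"] by (simp add: inner_sharp)
  qed
  show "bivector_bracket P (bivector_bracket P f g) h x + bivector_bracket P (bivector_bracket P g h) f x
      + bivector_bracket P (bivector_bracket P h f) g x = 0"
    unfolding iter[OF sm(1,2)] iter[OF sm(2,3)] iter[OF sm(3,1)]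
    using hess_symmetric[OF sm(1) \<open>x \<in> U\<close>, of "sharp x (total_grad h x)" "sharp x (total_grad g x)"]
      hess_symmetric[OF sm(2) \<open>x \<in> U\<close>, of "sharp x (total_grad h x)" "sharp x (total_grad f x)"]
      hess_symmetric[OF sm(3) \<open>x \<in> U\<close>, of "sharp x (total_grad f x)" "sharp x (total_grad g x)"]
      cyc[OF \<open>x \<in> M\<close>, of "total_grad f x" "total_grad g x" "total_grad h x"]
    by linarith
qed

end

section \<open>The rank one brackets\<close>

text \<open>For \<open>\<kappa> = 0\<close> this is, up to sign, the Lie--Poisson structure of the Euclidean Lie algebra \<open>se(3)\<close>.\<close>

definition so3_bivector ::
  "((real^3) \<times> (real^3) \<Rightarrow> real) \<Rightarrow> (real^3) \<times> (real^3) \<Rightarrow>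
    (real^3) \<times> (real^3) \<Rightarrow> (real^3) \<times> (real^3) \<Rightarrow> real" where
  "so3_bivector \<kappa> x a b =
     - ((snd x + \<kappa> x *\<^sub>R fst x) \<bullet> cross3 (snd a) (snd b))
     - fst x \<bullet> (cross3 (snd a) (fst b) - cross3 (snd b) (fst a))"

lemma open_punctured_space: "open punctured_space"
proof -
  have "punctured_space = fst -` (- {0 :: real^3})"
    by (auto simp: punctured_space_def)
  then show ?thesis
    by (metis open_Compl closed_singleton open_vimage_fst)
qed

lemma phase_space_subset: "phase_space \<subseteq> punctured_space"
  by (auto simp: phase_space_def punctured_space_def)

lemma bilinear_so3_bivector: "bilinear (so3_bivector \<kappa> x)"
  unfolding bilinear_def linear_iff so3_bivector_def
  by (simp add: cross_add_left cross_add_right cross_mult_left cross_mult_right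
      inner_add_right inner_diff_right algebra_simps)

lemma so3_bivector_skew: "so3_bivector \<kappa> x a b = - so3_bivector \<kappa> x b a"
  unfolding so3_bivector_def using cross_skew[of "snd a" "snd b"]
  by (simp add: inner_diff_right)

lemma smooth_so3_bivector:
  assumes "open U" "smooth_on U \<kappa>"
  shows "smooth_on U (\<lambda>x. so3_bivector \<kappa> x a b)"
proof -
  have lin: "smooth_on U (\<lambda>x. fst x \<bullet> c)" "smooth_on U (\<lambda>x. snd x \<bullet> c)" for c :: "real^3"
    by (intro smooth_on_inner_bounded_linear smooth_on_bounded_linear
        bounded_linear_inner_left_comp bounded_linear_fst bounded_linear_snd)+
  show ?thesis
    unfolding so3_bivector_def inner_add_left inner_scaleR_left
    by (intro smooth_on_diff smooth_on_minus smooth_on_add smooth_on_mult assms lin)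
qed

text \<open>Used both with the conformal factor and with \<phi> constantly 1.\<close>

lemma smooth_bivector_so3:
  assumes "open U" "smooth_on U \<phi>" "smooth_on U \<kappa>"
  shows "smooth_bivector U (\<lambda>x a b. \<phi> x * so3_bivector \<kappa> x a b)"
proof
  show "bilinear (\<lambda>a b. \<phi> x * so3_bivector \<kappa> x a b)" for x
    using bilinear_so3_bivector[of \<kappa> x] unfolding bilinear_def linear_iff
    by (simp add: algebra_simps)
  show "\<phi> x * so3_bivector \<kappa> x a b = - (\<phi> x * so3_bivector \<kappa> x b a)" for x a b
    using so3_bivector_skew[of \<kappa> x a b] by simp
  show "smooth_on U (\<lambda>x. \<phi> x * so3_bivector \<kappa> x a b)" for a b
    using assms by (intro smooth_on_mult smooth_so3_bivector)
qed fact

section \<open>Partial gradients and restriction to the unit sphere\<close>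

text \<open>Chain rule for the affine inclusion of the slice with fixed \<open>K\<close>.\<close>

lemma d_gamma_eq:
  assumes "f differentiable (at (\<gamma>, K))"
  shows "d_gamma f (\<gamma>, K) = fst (total_grad f (\<gamma>, K))"
proof -
  let ?D = "frechet_derivative f (at (\<gamma>, K))"
  have "((\<lambda>c. (c, K)) has_derivative (\<lambda>u. (u, 0))) (at \<gamma>)"
    by (auto intro!: derivative_eq_intros)
  moreover have "(f has_derivative ?D) (at (\<gamma>, K))"
    using assms by (simp add: frechet_derivative_works)
  ultimately have "((\<lambda>c. f (c, K)) has_derivative (\<lambda>u. ?D (u, 0))) (at \<gamma>)"
    using diff_chain_at[of "\<lambda>c. (c, K)"] by (fastforce simp: o_def)
  then have "d_gamma f (\<gamma>, K) $ i = ?D (axis i 1, 0)" for i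
    by (simp add: d_gamma_def grad_def frechet_derivative_at[symmetric])
  then show ?thesis
    using total_grad_inner[OF assms, of "(axis i 1, 0)" for i]
    by (simp add: vec_eq_iff inner_prod_def inner_axis)
qed

lemma d_K_eq:
  assumes "f differentiable (at (\<gamma>, K))"
  shows "d_K f (\<gamma>, K) = snd (total_grad f (\<gamma>, K))"
proof -
  let ?D = "frechet_derivative f (at (\<gamma>, K))"
  have "((\<lambda>k. (\<gamma>, k)) has_derivative (\<lambda>u. (0, u))) (at K)"
    by (auto intro!: derivative_eq_intros)
  moreover have "(f has_derivative ?D) (at (\<gamma>, K))"
    using assms by (simp add: frechet_derivative_works)
  ultimately have "((\<lambda>k. f (\<gamma>, k)) has_derivative (\<lambda>u. ?D (0, u))) (at K)"
    using diff_chain_at[of "\<lambda>k. (\<gamma>, k)"] by (fastforce simp: o_def)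
  then have "d_K f (\<gamma>, K) $ i = ?D (0, axis i 1)" for i
    by (simp add: d_K_def grad_def frechet_derivative_at[symmetric])
  then show ?thesis
    using total_grad_inner[OF assms, of "(0, axis i 1)" for i]
    by (simp add: vec_eq_iff inner_prod_def inner_axis)
qed

text \<open>A function vanishing on \<open>\<parallel>\<gamma>\<parallel> = 1\<close> has \<open>\<partial>f/\<partial>K = 0\<close> and \<open>\<partial>f/\<partial>\<gamma>\<close> parallel to \<open>\<gamma>\<close>
  there: differentiate it along the great circles through \<open>\<gamma>\<close>.\<close>

lemma total_grad_vanishing_on_phase_space:
  assumes "smooth_on punctured_space f" and van: "\<And>x. x \<in> phase_space \<Longrightarrow> f x = 0"
    and "x \<in> phase_space" and "fst x \<bullet> u = 0"
  shows "total_grad f x \<bullet> (u, v) = 0"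
proof -
  obtain \<gamma> K where x: "x = (\<gamma>, K)" and n\<gamma>: "\<gamma> \<bullet> \<gamma> = 1"
    using assms(3) by (auto simp: phase_space_def norm_eq_1)
  \<comment> \<open>A great circle run through with speed \<open>norm u\<close>, so that the initial
    velocity is \<open>u\<close>, together with a straight line in \<open>K\<close>. As
    \<open>sgn 0 = 0\<close>, the case \<open>u = 0\<close> gives a constant first
    component.\<close>
  define c where "c = (\<lambda>t. (cos (t * norm u) *\<^sub>R \<gamma> + sin (t * norm u) *\<^sub>R sgn u, K + t *\<^sub>R v))"
  have "(c has_derivative (\<lambda>t. t *\<^sub>R (u, v))) (at 0)"
    unfolding c_def
    by (rule has_derivative_eq_rhs, (rule derivative_intros)+)
       (auto simp: fun_eq_iff sgn_div_norm)
  moreover have "c 0 = x"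
    by (simp add: c_def x)
  then have "(f has_derivative (\<lambda>w. total_grad f x \<bullet> w)) (at (c 0))"
    using has_derivative_total_grad[OF assms(1), of x] assms(3) phase_space_subset by auto
  ultimately have "(f \<circ> c has_derivative (\<lambda>t. total_grad f x \<bullet> (t *\<^sub>R (u, v)))) (at 0)"
    using diff_chain_at[of c _ 0 f] by (simp add: o_def)
  moreover have "f \<circ> c = (\<lambda>t. 0)"
  proof
    fix t
    have "u = 0 \<or> norm (fst (c t)) = 1"
    proof (cases "u = 0")
      case False
      then have "sgn u \<bullet> sgn u = 1"
        by (simp add: norm_eq_1[symmetric] norm_sgn)
      moreover have "\<gamma> \<bullet> sgn u = 0"
        using assms(4) x by (simp add: sgn_div_norm)
      ultimately show ?thesis
        using n\<gamma> by (simp add: c_def norm_eq_1 inner_add_left inner_add_right inner_commute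
            power2_eq_square[symmetric])
    qed simp
    then have "c t \<in> phase_space"
      using n\<gamma> by (auto simp: phase_space_def c_def norm_eq_1)
    then show "(f \<circ> c) t = 0" by (simp add: van)
  qed
  ultimately have "((\<lambda>t. 0) has_derivative (\<lambda>t. total_grad f x \<bullet> (t *\<^sub>R (u, v)))) (at (0::real))"
    by simp
  then have "(\<lambda>t::real. total_grad f x \<bullet> (t *\<^sub>R (u, v))) = (\<lambda>t. 0)"
    using has_derivative_unique has_derivative_const by blast
  from fun_cong[OF this, of 1] show ?thesis by simp
qed

text \<open>All directions \<open>(0, v)\<close> are tangent, so the \<open>K\<close>-gradient of
  \<open>f\<close> vanishes and the \<kappa> term with it. The remaining triple product vanishes
  because the \<gamma>-gradient is orthogonal to every \<open>cross3 (fst x) w\<close>.\<close>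

lemma so3_bivector_restricts_to_phase_space:
  "restricts_to punctured_space phase_space (bivector_bracket (so3_bivector \<kappa>))"
  unfolding restricts_to_def
proof (intro allI impI ballI, elim conjE)
  fix f g and x :: "(real^3) \<times> (real^3)"
  assume f: "smooth_on punctured_space f" "\<forall>x\<in>phase_space. f x = 0" and x: "x \<in> phase_space"
  have tang: "total_grad f x \<bullet> (u, v) = 0" if "fst x \<bullet> u = 0" for u v
    using total_grad_vanishing_on_phase_space[OF f(1) _ x that] f(2) by blast
  have "snd (total_grad f x) = 0"
    using tang[of 0 "snd (total_grad f x)"] by (simp add: inner_prod_def)
  moreover have "fst (total_grad f x) \<bullet> cross3 (fst x) w = 0" for w
    using tang[of "cross3 (fst x) w" 0] by (simp add: inner_prod_def dot_cross_self)
  then have "fst x \<bullet> cross3 w (fst (total_grad f x)) = 0" for w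
    by (metis cross_triple inner_commute)
  ultimately show "bivector_bracket (so3_bivector \<kappa>) f g x = 0"
    by (simp add: bivector_bracket_def so3_bivector_def)
qed

section \<open>Cyclic identities for the cross product\<close>

text \<open>The pointwise Jacobi identity of the structure with \<kappa> = 0: \<open>S\<close> is
  the derivative of the bivector with frozen arguments \<open>a\<close>, \<open>b\<close> along the
  Hamiltonian vector of \<open>c\<close>.\<close>

lemma cross_cyclic_conformal:
  fixes g K a1 a2 b1 b2 c1 c2 :: "real^3"
  defines "S \<equiv> \<lambda>a1 a2 b1 b2 c1 c2. (cross3 c2 K + cross3 c1 g) \<bullet> cross3 a2 b2
    - cross3 g c2 \<bullet> (cross3 a2 b1 - cross3 b2 a1)"
  shows "S a1 a2 b1 b2 c1 c2 + S b1 b2 c1 c2 a1 a2 + S c1 c2 a1 a2 b1 b2 = 0"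
  unfolding S_def cross3_def inner_vec_def sum_3 by (simp add: algebra_simps)

text \<open>The trace identity \<open>(Lc)\<cdot>(a \<times> b) + \<dots> = tr(L) a\<cdot>(b \<times> c)\<close> for \<open>L = u v\<^sup>T\<close>.\<close>

lemma cross_cyclic_trace:
  fixes u v a b c :: "real^3"
  shows "(v \<bullet> c) * (u \<bullet> cross3 a b) + (v \<bullet> a) * (u \<bullet> cross3 b c) + (v \<bullet> b) * (u \<bullet> cross3 c a) =
    (v \<bullet> u) * (a \<bullet> cross3 b c)"
  unfolding cross3_def inner_vec_def sum_3 by (simp add: algebra_simps)

text \<open>Applied with \<open>p = J\<gamma>\<close> and \<open>h = JK\<close>, but these vectors may be arbitrary.\<close>

lemma cross_cyclic_inertia:
  fixes g K p h a1 a2 b1 b2 c1 c2 :: "real^3"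
  defines "S \<equiv> \<lambda>a1 a2 b1 b2 c1 c2.
    2 * (K \<bullet> p) * (cross3 c2 g \<bullet> cross3 a2 b2)
    - (p \<bullet> cross3 g c2) * (K \<bullet> cross3 a2 b2 + g \<bullet> (cross3 a2 b1 - cross3 b2 a1))
    - (h \<bullet> cross3 g c2 - (cross3 c2 K + cross3 c1 g) \<bullet> p) * (g \<bullet> cross3 a2 b2)"
  shows "S a1 a2 b1 b2 c1 c2 + S b1 b2 c1 c2 a1 a2 + S c1 c2 a1 a2 b1 b2 = 0"
proof -
  note coords = cross3_def inner_vec_def sum_3
  \<comment> \<open>Each scalar coefficient becomes a linear form in \<open>c\<close>, as in the
    trace identity; the last equation equates the two traces in the sum of
    \<open>?B\<close>.\<close>
  have cyc: "cross3 c K \<bullet> p = cross3 K p \<bullet> c" "p \<bullet> cross3 g c = cross3 p g \<bullet> c"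
      "h \<bullet> cross3 g c = cross3 h g \<bullet> c" "cross3 K p \<bullet> g = cross3 p g \<bullet> K" for c
    by (simp_all add: coords algebra_simps)
  \<comment> \<open>\<open>?A\<close> sums to zero by the Jacobi identity of the cross product
    paired with \<open>g\<close>, and \<open>?C\<close> because \<open>cross3 h g\<close> is
    orthogonal to \<open>g\<close>. \<open>?D\<close> gathers the terms containing one of
    \<open>a1\<close>, \<open>b1\<close>, \<open>c1\<close>, which come from different summands of
    the cyclic sum; it is the trace identity for \<open>cross3 p g\<close> and
    \<open>g\<close>.\<close>
  let ?A = "\<lambda>a b c. cross3 c g \<bullet> cross3 a b"
  let ?B = "\<lambda>a b c. (cross3 c K \<bullet> p) * (g \<bullet> cross3 a b) - (p \<bullet> cross3 g c) * (K \<bullet> cross3 a b)"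
  let ?C = "\<lambda>a b c. (h \<bullet> cross3 g c) * (g \<bullet> cross3 a b)"
  let ?D = "\<lambda>a b c. (cross3 c g \<bullet> p) * (g \<bullet> cross3 a b)
    - (p \<bullet> cross3 g a) * (g \<bullet> cross3 b c) + (p \<bullet> cross3 g b) * (g \<bullet> cross3 a c)"
  have "?A a2 b2 c2 + ?A b2 c2 a2 + ?A c2 a2 b2 = 0"
    unfolding coords by (simp add: algebra_simps)
  moreover have "?B a2 b2 c2 + ?B b2 c2 a2 + ?B c2 a2 b2 = 0"
    using cross_cyclic_trace[of "cross3 K p" c2 g a2 b2] cross_cyclic_trace[of "cross3 p g" c2 K a2 b2]
    by (simp add: cyc algebra_simps)
  moreover have "?C a2 b2 c2 + ?C b2 c2 a2 + ?C c2 a2 b2 = 0"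
    using cross_cyclic_trace[of "cross3 h g" c2 g a2 b2] by (simp add: cyc dot_cross_self)
  moreover have "?D a b c = 0" for a b c
    unfolding coords by (simp add: algebra_simps)
  ultimately have "2 * (K \<bullet> p) * (?A a2 b2 c2 + ?A b2 c2 a2 + ?A c2 a2 b2)
      + (?B a2 b2 c2 + ?B b2 c2 a2 + ?B c2 a2 b2)
      - (?C a2 b2 c2 + ?C b2 c2 a2 + ?C c2 a2 b2)
      + (?D a2 b2 c1 + ?D b2 c2 a1 + ?D c2 a2 b1) = 0"
    by simp
  then show ?thesis
    unfolding S_def by (simp add: inner_add_left inner_diff_right algebra_simps)
qed

section \<open>The scaled extended bracket\<close>

text \<open>Positivity makes \<open>N\<close> positive away from zero; symmetry of \<open>J\<close>
  lets the derivatives of the quadratic terms be written with \<open>J \<gamma>\<close> and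
  \<open>J K\<close>.\<close>

locale metric_conformal =
  fixes k :: real and J :: "real^3 \<Rightarrow> real^3"
  assumes k_nonneg: "0 \<le> k" and linear_J: "linear J"
    and J_symmetric: "J x \<bullet> y = x \<bullet> J y" and J_nonneg: "0 \<le> x \<bullet> J x"
begin

definition N :: "real^3 \<Rightarrow> real" where "N \<gamma> = \<gamma> \<bullet> \<gamma> + k * (\<gamma> \<bullet> J \<gamma>)"

definition factor :: "(real^3) \<times> (real^3) \<Rightarrow> real" where "factor x = sqrt (N (fst x))"

definition coeff :: "(real^3) \<times> (real^3) \<Rightarrow> real" where
  "coeff x = k * (snd x \<bullet> J (fst x)) / N (fst x)"

lemma N_pos: "\<gamma> \<noteq> 0 \<Longrightarrow> 0 < N \<gamma>"
  using k_nonneg J_nonneg[of \<gamma>] by (simp add: N_def add_pos_nonneg)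

lemma factor_pos: "x \<in> punctured_space \<Longrightarrow> 0 < factor x"
  by (auto simp: punctured_space_def factor_def N_pos)

lemma smooth_inner_J:
  assumes "bounded_linear f" "bounded_linear g"
  shows "smooth_on punctured_space (\<lambda>x. f x \<bullet> J (g x))"
  by (rule smooth_on_inner_bounded_linear[OF open_punctured_space assms(1)
        bounded_linear_compose[OF linear_J[unfolded linear_conv_bounded_linear] assms(2)]])

lemma smooth_N: "smooth_on punctured_space (\<lambda>x. N (fst x))"
  unfolding N_def
  by (rule smooth_on_add[OF open_punctured_space
        smooth_on_inner_bounded_linear[OF open_punctured_space bounded_linear_fst bounded_linear_fst]
        smooth_on_mult[OF open_punctured_space smooth_on_const
          smooth_inner_J[OF bounded_linear_fst bounded_linear_fst]]])

lemma smooth_factor: "smooth_on punctured_space factor"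
  unfolding factor_def[abs_def]
  by (intro smooth_on_sqrt open_punctured_space smooth_N) (auto simp: punctured_space_def N_pos)

lemma smooth_coeff: "smooth_on punctured_space coeff"
  unfolding coeff_def[abs_def]
  by (rule smooth_on_divide[OF open_punctured_space smooth_on_mult[OF open_punctured_space
          smooth_on_const smooth_inner_J[OF bounded_linear_snd bounded_linear_fst]] smooth_N])
     (auto simp: punctured_space_def dest: N_pos)

sublocale bivector: smooth_bivector punctured_space "\<lambda>x a b. factor x * so3_bivector coeff x a b"
  by (intro smooth_bivector_so3 open_punctured_space smooth_factor smooth_coeff)

text \<open>As \<open>N\<close> is the square of \<open>factor\<close>, the product of
  \<open>factor\<close> and \<open>coeff\<close> is a single quotient by \<open>factor\<close>, and
  no separate derivative of \<open>coeff\<close> is needed.\<close>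

lemma bivector_eq:
  assumes "x \<in> punctured_space"
  shows "factor x * so3_bivector coeff x a b =
    - (factor x * (snd x \<bullet> cross3 (snd a) (snd b)))
    - k * (snd x \<bullet> J (fst x)) / factor x * (fst x \<bullet> cross3 (snd a) (snd b))
    - factor x * (fst x \<bullet> (cross3 (snd a) (fst b) - cross3 (snd b) (fst a)))"
proof -
  have "N (fst x) = factor x * factor x"
    using N_pos[of "fst x"] assms by (auto simp: factor_def punctured_space_def)
  then have "factor x * coeff x = k * (snd x \<bullet> J (fst x)) / factor x"
    using factor_pos[OF assms] by (simp add: coeff_def)
  moreover have "factor x * so3_bivector coeff x a b =
    - (factor x * (snd x \<bullet> cross3 (snd a) (snd b)))
    - (factor x * coeff x) * (fst x \<bullet> cross3 (snd a) (snd b))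
    - factor x * (fst x \<bullet> (cross3 (snd a) (fst b) - cross3 (snd b) (fst a)))"
    by (simp add: so3_bivector_def inner_add_left algebra_simps)
  ultimately show ?thesis by simp
qed

lemma bivector_has_derivative:
  assumes "x = (\<gamma>, K)" "\<gamma> \<noteq> 0"
  defines "\<phi> \<equiv> factor x" and "d\<phi> \<equiv> \<lambda>w. (\<gamma> \<bullet> fst w + k * (J \<gamma> \<bullet> fst w)) / factor x"
  shows "((\<lambda>y. factor y * so3_bivector coeff y a b) has_derivative (\<lambda>w.
    - (d\<phi> w * (K \<bullet> cross3 (snd a) (snd b)) + \<phi> * (snd w \<bullet> cross3 (snd a) (snd b)))
    - k * ((snd w \<bullet> J \<gamma> + J K \<bullet> fst w) / \<phi> - (K \<bullet> J \<gamma>) * d\<phi> w / (\<phi> * \<phi>))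
      * (\<gamma> \<bullet> cross3 (snd a) (snd b))
    - k * (K \<bullet> J \<gamma>) / \<phi> * (fst w \<bullet> cross3 (snd a) (snd b))
    - (d\<phi> w * (\<gamma> \<bullet> (cross3 (snd a) (fst b) - cross3 (snd b) (fst a)))
      + \<phi> * (fst w \<bullet> (cross3 (snd a) (fst b) - cross3 (snd b) (fst a)))))) (at x)"
proof -
  have xU: "x \<in> punctured_space"
    using assms by (simp add: punctured_space_def)
  have pos: "0 < \<phi>" "\<phi> \<noteq> 0"
    using factor_pos[OF xU] by (auto simp: \<phi>_def)
  have dJ: "((\<lambda>y :: (real^3) \<times> (real^3). J (fst y)) has_derivative (\<lambda>w. J (fst w))) (at x)"
    using linear_J by (intro bounded_linear.has_derivative[of J] has_derivative_fst has_derivative_ident)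
      (simp add: linear_conv_bounded_linear)
  have halve: "2 * X * (inverse s / 2) = X / s" for X s :: real
    by (simp add: inverse_eq_divide)
  have "((\<lambda>y. N (fst y)) has_derivative
      (\<lambda>w. 2 * (\<gamma> \<bullet> fst w + k * (J \<gamma> \<bullet> fst w)))) (at x)"
    unfolding N_def
    by (rule has_derivative_eq_rhs, (rule derivative_intros dJ)+)
       (simp add: assms(1) fun_eq_iff J_symmetric inner_commute algebra_simps)
  then have "(factor has_derivative
      (\<lambda>w. 2 * (\<gamma> \<bullet> fst w + k * (J \<gamma> \<bullet> fst w)) * (inverse (sqrt (N \<gamma>)) / 2))) (at x)"
    unfolding factor_def[abs_def]
    using has_derivative_real_sqrt[where g = "\<lambda>y. N (fst y)" and x = x] N_pos[OF assms(2)] assms(1)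
    by simp
  then have d\<phi>: "(factor has_derivative d\<phi>) (at x)"
    by (rule has_derivative_eq_rhs) (simp only: d\<phi>_def factor_def assms(1) fst_conv halve)
  \<comment> \<open>The cross products do not depend on \<open>y\<close>, so they are abstracted to
    constants \<alpha> and \<beta> before differentiating.\<close>
  have "((\<lambda>y. - (factor y * (snd y \<bullet> \<alpha>))
      - k * (snd y \<bullet> J (fst y)) / factor y * (fst y \<bullet> \<alpha>)
      - factor y * (fst y \<bullet> \<beta>)) has_derivative (\<lambda>w.
    - (d\<phi> w * (K \<bullet> \<alpha>) + \<phi> * (snd w \<bullet> \<alpha>))
    - k * ((snd w \<bullet> J \<gamma> + J K \<bullet> fst w) / \<phi> - (K \<bullet> J \<gamma>) * d\<phi> w / (\<phi> * \<phi>)) * (\<gamma> \<bullet> \<alpha>)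
    - k * (K \<bullet> J \<gamma>) / \<phi> * (fst w \<bullet> \<alpha>)
    - (d\<phi> w * (\<gamma> \<bullet> \<beta>) + \<phi> * (fst w \<bullet> \<beta>)))) (at x)" for \<alpha> \<beta>
    by (rule has_derivative_eq_rhs, (rule derivative_intros dJ d\<phi> pos(2)[unfolded \<phi>_def])+)
       (simp add: fun_eq_iff assms(1) \<phi>_def[symmetric, unfolded assms(1)] J_symmetric
        algebra_simps divide_inverse)
  then show ?thesis
    by (rule has_derivative_transform_within_open[OF _ open_punctured_space xU])
       (simp add: bivector_eq)
qed

text \<open>Cyclic permutation of the triple products isolates the first covector.\<close>

lemma sharp_eq:
  assumes "x = (\<gamma>, K)" "\<gamma> \<noteq> 0"
  shows "bivector.sharp x c =
    (factor x *\<^sub>R cross3 \<gamma> (snd c),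
     - (factor x *\<^sub>R cross3 (snd c) K + (k * (K \<bullet> J \<gamma>) / factor x) *\<^sub>R cross3 (snd c) \<gamma>
        + factor x *\<^sub>R cross3 (fst c) \<gamma>))" (is "_ = ?s")
proof -
  have cyc: "u \<bullet> cross3 v w = v \<bullet> cross3 w u" for u v w :: "real^3"
    by (metis cross_triple inner_commute)
  have "e \<bullet> bivector.sharp x c = e \<bullet> ?s" for e
    unfolding bivector.inner_sharp
    using assms
    by (subst bivector_eq) (auto simp: punctured_space_def inner_prod_def inner_diff_right
        inner_add_right cyc[of K] cyc[of \<gamma>] cyc[of "snd c"] cross_skew[of \<gamma> "fst c"] algebra_simps)
  then show ?thesis
    using vector_eq_ldot by blast
qed

text \<open>All negative powers of \<open>factor x\<close> cancel, leaving its square times the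
  summand of \<open>cross_cyclic_conformal\<close> plus \<open>k\<close> times that of
  \<open>cross_cyclic_inertia\<close> for \<open>p = J \<gamma>\<close> and
  \<open>h = J K\<close>.\<close>

lemma derivative_along_sharp:
  fixes a b c :: "(real^3) \<times> (real^3)"
  assumes "x = (\<gamma>, K)" "\<gamma> \<noteq> 0"
  defines "\<alpha> \<equiv> cross3 (snd a) (snd b)" and "\<beta> \<equiv> cross3 (snd a) (fst b) - cross3 (snd b) (fst a)"
  shows "frechet_derivative (\<lambda>y. factor y * so3_bivector coeff y a b) (at x) (bivector.sharp x c) =
    (factor x)\<^sup>2 * ((cross3 (snd c) K + cross3 (fst c) \<gamma>) \<bullet> \<alpha> - cross3 \<gamma> (snd c) \<bullet> \<beta>) +
    k * (2 * (K \<bullet> J \<gamma>) * (cross3 (snd c) \<gamma> \<bullet> \<alpha>)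
      - (J \<gamma> \<bullet> cross3 \<gamma> (snd c)) * (K \<bullet> \<alpha> + \<gamma> \<bullet> \<beta>)
      - (J K \<bullet> cross3 \<gamma> (snd c) - (cross3 (snd c) K + cross3 (fst c) \<gamma>) \<bullet> J \<gamma>) * (\<gamma> \<bullet> \<alpha>))"
proof -
  define \<phi> where "\<phi> = factor x"
  define p where "p = J \<gamma>"
  define R where "R = cross3 \<gamma> (snd c)"
  define q where "q = k * (K \<bullet> p)"
  define u where "u = \<phi> *\<^sub>R R"
  define v where "v = - (\<phi> *\<^sub>R cross3 (snd c) K - (q / \<phi>) *\<^sub>R R + \<phi> *\<^sub>R cross3 (fst c) \<gamma>)"
  define d where "d = (\<gamma> \<bullet> u + k * (p \<bullet> u)) / \<phi>"
  have "x \<in> punctured_space"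
    using assms by (simp add: punctured_space_def)
  then have nz: "\<phi> \<noteq> 0"
    using factor_pos[of x] by (simp add: \<phi>_def)
  have skewR: "cross3 (snd c) \<gamma> = - R"
    unfolding R_def by (rule cross_skew)
  have sharp: "bivector.sharp x c = (u, v)"
    unfolding sharp_eq[OF assms(1,2)] u_def v_def q_def p_def \<phi>_def skewR R_def[symmetric] by simp
  \<comment> \<open>\<open>d\<close> is the derivative of the factor along the Hamiltonian vector;
    \<gamma> is orthogonal to \<open>R\<close>, so only the inertia term survives.\<close>
  have d: "d = k * (p \<bullet> R)"
    using nz by (simp add: d_def u_def) (simp add: R_def dot_cross_self)
  have v\<alpha>: "\<phi> * (v \<bullet> \<alpha>) = - (\<phi>\<^sup>2 * (cross3 (snd c) K \<bullet> \<alpha>)) + q * (R \<bullet> \<alpha>) - \<phi>\<^sup>2 * (cross3 (fst c) \<gamma> \<bullet> \<alpha>)"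
    using nz by (simp add: v_def inner_diff_left inner_add_left power2_eq_square algebra_simps)
  \<comment> \<open>The term in \<open>v \<bullet> p\<close> that comes from
    \<open>q / \<phi>\<close> cancels against the term with \<open>d\<close>.\<close>
  have bracket: "(v \<bullet> p + J K \<bullet> u) / \<phi> - (K \<bullet> p) * d / (\<phi> * \<phi>) =
      J K \<bullet> R - (cross3 (snd c) K + cross3 (fst c) \<gamma>) \<bullet> p"
    using nz unfolding d
    by (simp add: v_def u_def q_def inner_diff_left inner_add_left inner_commute[of R] field_simps)
  have "frechet_derivative (\<lambda>y. factor y * so3_bivector coeff y a b) (at x) (u, v) =
    - (d * (K \<bullet> \<alpha>) + \<phi> * (v \<bullet> \<alpha>))
    - k * ((v \<bullet> p + J K \<bullet> u) / \<phi> - (K \<bullet> p) * d / (\<phi> * \<phi>)) * (\<gamma> \<bullet> \<alpha>)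
    - q / \<phi> * (u \<bullet> \<alpha>) - (d * (\<gamma> \<bullet> \<beta>) + \<phi> * (u \<bullet> \<beta>))"
    unfolding frechet_derivative_at[OF bivector_has_derivative[OF assms(1,2)], symmetric]
    unfolding \<alpha>_def \<beta>_def \<phi>_def p_def d_def q_def by simp
  \<comment> \<open>Together with the equal contribution inside \<open>v\<alpha>\<close> this
    produces the coefficient 2 in the result.\<close>
  also have "q / \<phi> * (u \<bullet> \<alpha>) = q * (R \<bullet> \<alpha>)"
    using nz by (simp add: u_def)
  also have "\<phi> * (u \<bullet> \<beta>) = \<phi>\<^sup>2 * (R \<bullet> \<beta>)"
    by (simp add: u_def power2_eq_square)
  finally show ?thesis
    unfolding sharp v\<alpha> d bracket[unfolded d] skewR R_def[symmetric] \<phi>_def[symmetric] p_def[symmetric]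
    by (simp add: q_def inner_add_left algebra_simps)
qed

lemma jacobi_conformal:
  "jacobi_identity punctured_space punctured_space
    (bivector_bracket (\<lambda>x a b. factor x * so3_bivector coeff x a b))"
proof (rule bivector.jacobi[OF subset_refl])
  fix x a b c :: "(real^3) \<times> (real^3)"
  assume "x \<in> punctured_space"
  then obtain \<gamma> K where x: "x = (\<gamma>, K)" "\<gamma> \<noteq> 0"
    by (auto simp: punctured_space_def)
  let ?T = "\<lambda>a b. frechet_derivative (\<lambda>y. factor y * so3_bivector coeff y a b) (at x)"
  show "?T a b (bivector.sharp x c) + ?T b c (bivector.sharp x a) + ?T c a (bivector.sharp x b) = 0"
    unfolding derivative_along_sharp[OF x]
    using arg_cong[OF cross_cyclic_conformal[where g = \<gamma> and K = K
          and ?a1.0 = "fst a" and ?a2.0 = "snd a" and ?b1.0 = "fst b" and ?b2.0 = "snd b"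
          and ?c1.0 = "fst c" and ?c2.0 = "snd c"],
        of "\<lambda>t. (factor x)\<^sup>2 * t"]
      arg_cong[OF cross_cyclic_inertia[where g = \<gamma> and K = K and p = "J \<gamma>" and h = "J K"
          and ?a1.0 = "fst a" and ?a2.0 = "snd a" and ?b1.0 = "fst b" and ?b2.0 = "snd b"
          and ?c1.0 = "fst c" and ?c2.0 = "snd c"],
        of "\<lambda>t. k * t"]
    by (simp only: distrib_left mult_zero_right)
qed

end

section \<open>The inertia tensor and its inverse\<close>

text \<open>\<open>matrix_inv\<close> is defined by choice, so the given inverse first serves as a
  witness that the chosen matrix is an inverse; uniqueness of inverses then applies.\<close>

lemma matrix_inv_eqI:
  fixes A B :: "real^'n^'n"
  assumes "A ** B = mat 1" "B ** A = mat 1"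
  shows "matrix_inv A = B"
proof -
  have "matrix_inv A ** A = mat 1"
    using someI_ex[of "\<lambda>A'. A ** A' = mat 1 \<and> A' ** A = mat 1"] assms
    unfolding matrix_inv_def by blast
  then show ?thesis
    using assms(1) by (metis matrix_mul_assoc matrix_mul_lid matrix_mul_rid)
qed

lemma matrix_inv_inertia_tensor:
  assumes "a \<noteq> 0" "b \<noteq> 0" "c \<noteq> 0"
  shows "matrix_inv (inertia_tensor a b c) = inertia_tensor (1 / a) (1 / b) (1 / c)"
  by (rule matrix_inv_eqI)
     (use assms in \<open>simp_all add: inertia_tensor_def matrix_matrix_mult_def mat_def vec_eq_iff
        forall_3 sum_3 vector_def\<close>)

lemma inertia_tensor_mult:
  "inertia_tensor a b c *v x = vector [a * x $ 1, b * x $ 2, c * x $ 3]"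
  by (simp add: inertia_tensor_def matrix_vector_mult_def vec_eq_iff forall_3 sum_3 vector_def)

lemma metric_conformal_inertia_tensor:
  assumes "0 \<le> k" "0 \<le> a" "0 \<le> b" "0 \<le> c"
  shows "metric_conformal k ((*v) (inertia_tensor a b c))"
proof (rule metric_conformal.intro)
  show "0 \<le> x \<bullet> (inertia_tensor a b c *v x)" for x
  proof -
    have "x \<bullet> (inertia_tensor a b c *v x) = a * (x $ 1)\<^sup>2 + b * (x $ 2)\<^sup>2 + c * (x $ 3)\<^sup>2"
      by (simp add: inertia_tensor_mult inner_vec_def sum_3 power2_eq_square algebra_simps)
    then show ?thesis using assms by simp
  qed
  show "linear ((*v) (inertia_tensor a b c))"
    by simp
qed (use assms in \<open>simp_all add: inertia_tensor_mult inner_vec_def sum_3\<close>)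

theorem proposition2p4:
  fixes m r I\<^sub>1 I\<^sub>2 I\<^sub>3 :: real and II :: "real^3^3"
  assumes "m > 0" and "I\<^sub>1 > 0" and "I\<^sub>2 > 0" and "I\<^sub>3 > 0"
    and "II = inertia_tensor I\<^sub>1 I\<^sub>2 I\<^sub>3"
  shows
    "almost_poisson_bracket punctured_space punctured_space (rank1_bracket m r II) \<and>
     conformally_poisson punctured_space phase_space (rank1_bracket m r II) \<and>
     conformal_factor punctured_space phase_space (rank1_factor m r II) (rank1_bracket m r II) \<and>
     conformally_poisson punctured_space punctured_space (rank1_bracket_extended m r II) \<and>
     conformal_factor punctured_space punctured_space (rank1_factor m r II)
           (rank1_bracket_extended m r II)"
proof -
  let ?U = punctured_space and ?S = phase_space
  let ?J = "(*v) (matrix_inv II)" and ?k = "m * r\<^sup>2"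
  interpret metric_conformal ?k ?J
    using metric_conformal_inertia_tensor[of ?k "1 / I\<^sub>1" "1 / I\<^sub>2" "1 / I\<^sub>3"] assms
    by (simp add: matrix_inv_inertia_tensor)
  define B1 where "B1 = rank1_bracket m r II"
  define B2 where "B2 = rank1_bracket_extended m r II"
  \<comment> \<open>The coefficient belonging to the original bracket; it equals
    \<open>coeff\<close> exactly where \<open>coeff\<close> vanishes or \<gamma> has norm 1.\<close>
  define \<kappa> where "\<kappa> = (\<lambda>x. coeff x * (fst x \<bullet> fst x))"
  have \<phi>: "rank1_factor m r II = factor"
    by (simp add: fun_eq_iff rank1_factor_def factor_def N_def power2_norm_eq_inner)
  have smooth_\<kappa>: "smooth_on ?U \<kappa>"
    unfolding \<kappa>_def
    by (rule smooth_on_mult[OF open_punctured_space smooth_coeff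
          smooth_on_inner_bounded_linear[OF open_punctured_space bounded_linear_fst bounded_linear_fst]])
  \<comment> \<open>Pairing the formula for \<open>Omega\<close> with \<gamma> leaves
    \<open>N \<gamma> - k (\<gamma> \<bullet> J \<gamma>)\<close> in the numerator, which is the
    squared norm of \<gamma>.\<close>
  have Omega: "?k * (Omega m r II \<gamma> K \<bullet> \<gamma>) = \<kappa> (\<gamma>, K)" if "\<gamma> \<noteq> 0" for \<gamma> K
  proof -
    have "Omega m r II \<gamma> K \<bullet> \<gamma> =
        K \<bullet> ?J \<gamma> - ?k * ((K \<bullet> ?J \<gamma>) / N \<gamma>) * (\<gamma> \<bullet> ?J \<gamma>)"
      by (simp add: Omega_def N_def power2_norm_eq_inner inner_diff_left J_symmetric)
    also have "\<dots> = (K \<bullet> ?J \<gamma>) * (N \<gamma> - ?k * (\<gamma> \<bullet> ?J \<gamma>)) / N \<gamma>"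
      using N_pos[OF that] by (simp add: field_simps)
    also have "N \<gamma> - ?k * (\<gamma> \<bullet> ?J \<gamma>) = \<gamma> \<bullet> \<gamma>"
      by (simp add: N_def)
    finally show ?thesis
      by (simp add: \<kappa>_def coeff_def)
  qed
  have B1: "B1 f g x = bivector_bracket (so3_bivector \<kappa>) f g x"
    and B2: "B2 f g x = bivector_bracket (so3_bivector coeff) f g x"
    if sm: "smooth_on ?U f" "smooth_on ?U g" and xU: "x \<in> ?U" for f g x
  proof -
    obtain \<gamma> K where x: "x = (\<gamma>, K)" "\<gamma> \<noteq> 0"
      using xU by (auto simp: punctured_space_def)
    have diff: "f differentiable (at (\<gamma>, K))" "g differentiable (at (\<gamma>, K))"
      using sm[THEN smooth_on_differentiable, OF xU] x(1) by simp_all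
    show "B1 f g x = bivector_bracket (so3_bivector \<kappa>) f g x"
      unfolding B1_def rank1_bracket_def bivector_bracket_def so3_bivector_def x(1)
      using Omega[OF x(2)] diff by (simp add: d_gamma_eq d_K_eq)
    have "coeff (\<gamma>, K) = ?k * ((Omega m r II \<gamma> K \<bullet> \<gamma>) / (norm \<gamma>)\<^sup>2)"
      using Omega[OF x(2), of K] x(2) by (simp add: \<kappa>_def power2_norm_eq_inner field_simps)
    then show "B2 f g x = bivector_bracket (so3_bivector coeff) f g x"
      unfolding B2_def rank1_bracket_extended_def bivector_bracket_def so3_bivector_def x(1)
      using diff by (simp add: d_gamma_eq d_K_eq)
  qed
  have ap: "almost_poisson_bracket ?U ?U (bivector_bracket (so3_bivector c))"
    if "smooth_on ?U c" for c
    using smooth_bivector.almost_poisson[OF smooth_bivector_so3[OF open_punctured_space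
          smooth_on_const[of _ 1] that]] by simp
  note ap_S = almost_poisson_bracket_restrict[OF ap so3_bivector_restricts_to_phase_space]
  have ap_B1: "almost_poisson_bracket ?U ?U B1" "almost_poisson_bracket ?U ?S B1"
    by (rule almost_poisson_bracket_cong[OF open_punctured_space _ _ B1];
        use ap[OF smooth_\<kappa>] ap_S[OF smooth_\<kappa>] phase_space_subset in blast)+
  have ap_B2: "almost_poisson_bracket ?U ?U B2" "almost_poisson_bracket ?U ?S B2"
    by (rule almost_poisson_bracket_cong[OF open_punctured_space _ _ B2];
        use ap[OF smooth_coeff] ap_S[OF smooth_coeff] phase_space_subset in blast)+
  note scale = almost_poisson_bracket_scale[OF open_punctured_space smooth_factor]
  have "jacobi_identity ?U ?U (\<lambda>f g x. factor x * B2 f g x)"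
    by (rule jacobi_identity_cong[OF open_punctured_space subset_refl scale[OF ap_B2(1)]
          bivector.almost_poisson _ jacobi_conformal]) (simp add: B2 bivector_bracket_def)
  then have cf_B2: "conformal_factor ?U ?U factor B2"
    by (simp add: conformal_factor_def smooth_factor factor_pos)
  have "jacobi_identity ?U ?S (\<lambda>f g x. factor x * B2 f g x)"
    using cf_B2 phase_space_subset unfolding conformal_factor_def jacobi_identity_def by blast
  moreover have "B1 f g x = B2 f g x" if "smooth_on ?U f" "smooth_on ?U g" "x \<in> ?S" for f g x
  proof -
    have "\<kappa> x = coeff x"
      using that(3) by (auto simp: \<kappa>_def phase_space_def norm_eq_1)
    moreover have "x \<in> ?U"
      using that(3) phase_space_subset by blast
    ultimately show ?thesis
      using that by (simp add: B1 B2 bivector_bracket_def so3_bivector_def)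
  qed
  \<comment> \<open>The inner brackets of \<open>B1\<close> and \<open>B2\<close> may differ off the
    sphere, so the transfer rests on both scaled brackets restricting to it.\<close>
  ultimately have "jacobi_identity ?U ?S (\<lambda>f g x. factor x * B1 f g x)"
    by (intro jacobi_identity_cong[OF open_punctured_space phase_space_subset scale[OF ap_B1(2)]
          scale[OF ap_B2(2)]]) auto
  then have cf_B1: "conformal_factor ?U ?S factor B1"
    by (simp add: conformal_factor_def smooth_factor factor_pos)
  show ?thesis
    unfolding \<phi> B1_def[symmetric] B2_def[symmetric] conformally_poisson_def
    using ap_B1 ap_B2 cf_B1 cf_B2 by blast
qed

end
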